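(* The SHED problem is co-NP-complete, even when its input is restricted to graphs containing no cycle of length $3$.
   Context: All graphs are finite, simple, undirected and loopless. For $v\in V(G)$, $N(v)$ is the set of neighbours of $v$ and $N[v]=N(v)\cup\{v\}$. A set $S\subseteq V(G)$ is independent if its elements are pairwise nonadjacent. A vertex $v$ is shedding if for every independent set $S\subseteq V(G)\setminus N[v]$ there exists $u\in N(v)$ such that $S\cup\{u\}$ is independent (equivalently, no independent set contained in $V(G)\setminus N[v]$ dominates $N(v)$, where $S$ dominates $T$ if every vertex of $T$ is in $S$ or has a neighbour in $S$). The SHED problem: given a graph $G$ and a vertex $v\in V(G)$, decide whether $v$ is shedding. *)

theory Defs
  imports
    "Graph_Theory.Graph_Theory"
    "HOL-Computational_Algebra.Polynomial"
begin

section \<open>Shedding vertices\<close>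

text \<open>
  A finite simple undirected graph is a \<^locale>\<open>pair_graph\<close>: an undirected edge \<open>uw\<close> is the pair
  of opposite arcs \<open>(u, w)\<close>, \<open>(w, u)\<close>.
\<close>

definition nbhd :: "'a pair_pre_digraph \<Rightarrow> 'a \<Rightarrow> 'a set" where
  "nbhd G v = {u \<in> pverts G. (v, u) \<in> parcs G}"

definition closed_nbhd :: "'a pair_pre_digraph \<Rightarrow> 'a \<Rightarrow> 'a set" where
  "closed_nbhd G v = insert v (nbhd G v)"

definition indep_set :: "'a pair_pre_digraph \<Rightarrow> 'a set \<Rightarrow> bool" where
  "indep_set G S \<longleftrightarrow> S \<subseteq> pverts G \<and> (\<forall>u\<in>S. \<forall>w\<in>S. u \<noteq> w \<longrightarrow> (u, w) \<notin> parcs G)"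

definition shedding :: "'a pair_pre_digraph \<Rightarrow> 'a \<Rightarrow> bool" where
  "shedding G v \<longleftrightarrow> v \<in> pverts G \<and>
     (\<forall>S. S \<subseteq> pverts G - closed_nbhd G v \<and> indep_set G S \<longrightarrow>
          (\<exists>u \<in> nbhd G v. indep_set G (insert u S)))"

text \<open>
  In a symmetric digraph the library's directed cycles of length 2 are the walks \<open>u, w, u\<close>; from
  length 3 on, they are the cycles of the undirected graph.
\<close>

definition triangle_free :: "'a pair_pre_digraph \<Rightarrow> bool" where
  "triangle_free G \<longleftrightarrow> \<not> (\<exists>p. pre_digraph.cycle (with_proj G) p \<and> length p = 3)"


section \<open>Deterministic multi-tape Turing machines\<close>

text \<open>
  The states are \<open>0, \<dots>, nstates\<close>; computation starts in \<open>0\<close> and halts upon reaching \<open>nstates\<close>.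
  Tape symbols are \<open>0, \<dots>, nsymbols - 1\<close>, where \<open>0\<close> is the blank and \<open>1\<close>, \<open>2\<close> are the two input
  symbols. In each step the machine reads the symbols under its \<open>ntapes\<close> heads and then, on each
  tape, writes a symbol and moves the head by at most one cell.
\<close>

datatype move = Left | Stay | Right

record tm =
  ntapes :: nat
  nstates :: nat
  nsymbols :: nat
  delta :: "nat \<Rightarrow> nat list \<Rightarrow> nat \<times> (nat \<times> move) list"

definition wf_tm :: "tm \<Rightarrow> bool" where
  "wf_tm M \<longleftrightarrow> ntapes M \<ge> 1 \<and> nsymbols M \<ge> 3 \<and>
     (\<forall>s < nstates M. \<forall>rs. length rs = ntapes M \<and> set rs \<subseteq> {..<nsymbols M} \<longrightarrow>
        (case delta M s rs of (s', as) \<Rightarrow>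
           s' \<le> nstates M \<and> length as = ntapes M \<and> fst ` set as \<subseteq> {..<nsymbols M}))"

text \<open>A tape is infinite in both directions; it is given by its contents and its head position.\<close>

type_synonym tape = "(int \<Rightarrow> nat) \<times> int"
type_synonym config = "nat \<times> tape list"

fun head_symbol :: "tape \<Rightarrow> nat" where
  "head_symbol (f, h) = f h"

fun shift :: "move \<Rightarrow> int \<Rightarrow> int" where
  "shift Left h = h - 1"
| "shift Stay h = h"
| "shift Right h = h + 1"

fun act :: "nat \<times> move \<Rightarrow> tape \<Rightarrow> tape" where
  "act (a, m) (f, h) = (f(h := a), shift m h)"

fun tm_step :: "tm \<Rightarrow> config \<Rightarrow> config" where
  "tm_step M (s, ts) =
     (if s < nstates M
      then (case delta M s (map head_symbol ts) of (s', as) \<Rightarrow> (s', map2 act as ts))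
      else (s, ts))"

definition bit_symbol :: "bool \<Rightarrow> nat" where
  "bit_symbol b = (if b then 2 else 1)"

definition blank_tape :: tape where
  "blank_tape = ((\<lambda>_. 0), 0)"

definition input_tape :: "bool list \<Rightarrow> tape" where
  "input_tape x =
     ((\<lambda>i. if 0 \<le> i \<and> i < int (length x) then bit_symbol (x ! nat i) else 0), 0)"

text \<open>The input is on the first tape, all other tapes are blank.\<close>

definition init_config :: "tm \<Rightarrow> bool list \<Rightarrow> config" where
  "init_config M x = (0, input_tape x # replicate (ntapes M - 1) blank_tape)"

text \<open>The output is read on the last tape from cell \<open>0\<close> to the right, up to the first blank.\<close>

definition holds_output :: "tape \<Rightarrow> bool list \<Rightarrow> bool" where
  "holds_output t y \<longleftrightarrow>
     (\<forall>i < length y. fst t (int i) = bit_symbol (y ! i)) \<and> fst t (int (length y)) = 0"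

definition computes_in_time :: "tm \<Rightarrow> (bool list \<Rightarrow> bool list) \<Rightarrow> (nat \<Rightarrow> nat) \<Rightarrow> bool" where
  "computes_in_time M f T \<longleftrightarrow>
     (\<forall>x. \<exists>t \<le> T (length x).
        case (tm_step M ^^ t) (init_config M x) of (s, ts) \<Rightarrow>
          s = nstates M \<and> holds_output (last ts) (f x))"

definition poly_time :: "(bool list \<Rightarrow> bool list) \<Rightarrow> bool" where
  "poly_time f \<longleftrightarrow> (\<exists>M (p :: nat poly). wf_tm M \<and> computes_in_time M f (poly p))"


section \<open>Complexity classes\<close>

type_synonym language = "bool list set"

definition class_P :: "language set" where
  "class_P = {L. poly_time (\<lambda>x. [x \<in> L])}"

text \<open>Doubling the bits of \<open>x\<close> lets \<open>01\<close> serve as a separator.\<close>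

definition pair_code :: "bool list \<Rightarrow> bool list \<Rightarrow> bool list" where
  "pair_code x w = concat (map (\<lambda>b. [b, b]) x) @ [False, True] @ w"

definition class_NP :: "language set" where
  "class_NP = {L. \<exists>V \<in> class_P. \<exists>p :: nat poly. \<forall>x.
     x \<in> L \<longleftrightarrow> (\<exists>w. length w \<le> poly p (length x) \<and> pair_code x w \<in> V)}"

definition class_coNP :: "language set" where
  "class_coNP = {L. - L \<in> class_NP}"

definition poly_reducible :: "language \<Rightarrow> language \<Rightarrow> bool" where
  "poly_reducible L L' \<longleftrightarrow> (\<exists>f. poly_time f \<and> (\<forall>x. x \<in> L \<longleftrightarrow> f x \<in> L'))"

definition coNP_complete :: "language \<Rightarrow> bool" where
  "coNP_complete L \<longleftrightarrow> L \<in> class_coNP \<and> (\<forall>L' \<in> class_coNP. poly_reducible L' L)"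


section \<open>The problem SHED as a language\<close>

text \<open>
  For input purposes the vertices of a graph on \<open>n\<close> vertices are \<open>0, \<dots>, n - 1\<close>. An instance is
  encoded as \<open>1\<^sup>n 0 1\<^sup>v 0\<close> followed by the adjacency matrix, row by row.
\<close>

definition encode_instance :: "nat pair_pre_digraph \<Rightarrow> nat \<Rightarrow> bool list" where
  "encode_instance G v = (let n = card (pverts G) in
     replicate n True @ [False] @ replicate v True @ [False] @
     concat (map (\<lambda>i. map (\<lambda>j. (i, j) \<in> parcs G) [0..<n]) [0..<n]))"

text \<open>
  The language of the problem SHED with its input restricted to the graphs satisfying \<open>C\<close>. Strings
  that do not encode an admissible instance are not in the language.
\<close>

definition SHED_on :: "(nat pair_pre_digraph \<Rightarrow> bool) \<Rightarrow> language" where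
  "SHED_on C = {encode_instance G v | G v.
     pair_graph G \<and> pverts G = {..<card (pverts G)} \<and> C G \<and> v \<in> pverts G \<and> shedding G v}"

definition SHED :: language where
  "SHED = SHED_on (\<lambda>_. True)"

definition SHED_triangle_free :: language where
  "SHED_triangle_free = SHED_on triangle_free"

end

theory Submission
  imports Defs
begin

text \<open>
  An independent set that avoids \<open>N[v]\<close> and dominates \<open>N(v)\<close> certifies that \<open>v\<close> is not shedding, so
  SHED is in coNP. For hardness, satisfiability of a set of clauses is turned into a graph: \<open>v\<close> is
  adjacent to all clauses, each clause to its literals, each literal to its negation. Then \<open>v\<close> is not
  shedding iff the clauses are satisfiable, and a triangle could only arise from a clause containing
  a literal and its negation; Cook's clauses for a Turing machine
  include none of that kind.

  Membership of the verifier in P and polynomial time of the reduction both come from one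
  observation: functions built from the length and the bits of the input by addition, truncated
  subtraction and bounded summation have polynomially bounded values, hence can be computed with
  unary counters, and a counter is just the head position on a tape with a marked cell.
\<close>

section \<open>Counter programs\<close>

text \<open>Polynomial time is meant literally, for multi-tape machines, so the reduction should not
  have to build data structures. Its graph is therefore implicit: a vertex is a number whose digits
  in base \<open>B x\<close> say which literal or clause it is, and adjacency is an arithmetic
  predicate of the digits. Each output bit is then a function of its own position, which is all that
  the counter programs have to evaluate. Numbers describing nothing become isolated vertices, and a
  literal or clause may be described by several numbers; neither affects satisfiability.

  For the same reason the clauses are kept uniform. Every tape is drawn relative to its head, so the
  head column is the same number \<open>R x\<close> at all times, and a step shifts whole tracks.
  The price is that the origin of the output tape, where the verdict is read, wanders; an extra
  track follows it.

  One graph serves both claims, because hardness is shown for any restriction \<open>D\<close> that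
  admits all triangle-free graphs.\<close>

datatype prim = Inc nat | Dec nat | InL | InR | Test nat nat | Emit bool

datatype cmd = Prim prim | Seq cmd cmd | While nat cmd

type_synonym store = "(nat \<Rightarrow> nat) \<times> int \<times> bool list"

abbreviation in_sym :: "bool list \<Rightarrow> int \<Rightarrow> nat" where
  "in_sym x \<equiv> fst (input_tape x)"

fun prim_step :: "bool list \<Rightarrow> prim \<Rightarrow> store \<Rightarrow> store" where
  "prim_step x (Inc r) (\<sigma>, h, y) = (\<sigma>(r := Suc (\<sigma> r)), h, y)"
| "prim_step x (Dec r) (\<sigma>, h, y) = (\<sigma>(r := \<sigma> r - 1), h, y)"
| "prim_step x InL (\<sigma>, h, y) = (\<sigma>, h - 1, y)"
| "prim_step x InR (\<sigma>, h, y) = (\<sigma>, h + 1, y)"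
| "prim_step x (Test a r) (\<sigma>, h, y) = (\<sigma>(r := \<sigma> r + of_bool (a \<le> in_sym x h)), h, y)"
| "prim_step x (Emit b) (\<sigma>, h, y) = (\<sigma>, h, y @ [b])"

text \<open>The costs are exact machine steps: a failing loop test costs one, and each iteration
  pays for its test and for the jump back, whence the \<open>+ 2\<close>.\<close>

inductive exec :: "bool list \<Rightarrow> cmd \<Rightarrow> store \<Rightarrow> store \<Rightarrow> nat \<Rightarrow> bool" for x where
  Prim: "exec x (Prim p) s (prim_step x p s) 1"
| Seq: "exec x c1 s s1 t1 \<Longrightarrow> exec x c2 s1 s2 t2 \<Longrightarrow> exec x (Seq c1 c2) s s2 (t1 + t2)"
| While0: "fst s r = 0 \<Longrightarrow> exec x (While r c) s s 1"
| While1: "fst s r \<noteq> 0 \<Longrightarrow> exec x c s s1 t1 \<Longrightarrow> exec x (While r c) s1 s2 t2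
    \<Longrightarrow> exec x (While r c) s s2 (t1 + t2 + 2)"

fun prim_regs :: "prim \<Rightarrow> nat set" where
  "prim_regs (Inc r) = {r}"
| "prim_regs (Dec r) = {r}"
| "prim_regs (Test a r) = {r}"
| "prim_regs _ = {}"

fun regs :: "cmd \<Rightarrow> nat set" where
  "regs (Prim p) = prim_regs p"
| "regs (Seq c1 c2) = regs c1 \<union> regs c2"
| "regs (While r c) = insert r (regs c)"

lemma finite_regs: "finite (regs c)"
proof (induction c)
  case (Prim p) then show ?case by (cases p) auto
qed auto

datatype node = Do prim | Jz nat nat | Jmp nat

fun code_size :: "cmd \<Rightarrow> nat" where
  "code_size (Prim p) = 1"
| "code_size (Seq c1 c2) = code_size c1 + code_size c2"
| "code_size (While r c) = code_size c + 2"

fun code :: "nat \<Rightarrow> cmd \<Rightarrow> node list" where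
  "code n (Prim p) = [Do p]"
| "code n (Seq c1 c2) = code n c1 @ code (n + code_size c1) c2"
| "code n (While r c) = Jz r (n + code_size c + 2) # code (Suc n) c @ [Jmp n]"

lemma length_code [simp]: "length (code n c) = code_size c"
  by (induction c arbitrary: n) auto

section \<open>Compilation to Turing machines\<close>

fun node_next :: "nat \<Rightarrow> nat list \<Rightarrow> node \<Rightarrow> nat" where
  "node_next s rs (Do p) = Suc s"
| "node_next s rs (Jz r n) = (if rs ! Suc r = 1 then n else Suc s)"
| "node_next s rs (Jmp n) = n"

text \<open>
  Tape \<open>0\<close> is the input tape and tape \<open>K + 1\<close> the output tape. Counter \<open>r\<close> is the head position on
  tape \<open>r + 1\<close>, whose cell \<open>0\<close> holds the only nonblank symbol.
\<close>

fun node_act :: "nat \<Rightarrow> nat list \<Rightarrow> node \<Rightarrow> nat \<Rightarrow> nat \<times> move" where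
  "node_act K rs (Do (Inc r)) j = (rs ! j, if j = Suc r then Right else Stay)"
| "node_act K rs (Do (Dec r)) j = (rs ! j, if j = Suc r \<and> rs ! j \<noteq> 1 then Left else Stay)"
| "node_act K rs (Do InL) j = (rs ! j, if j = 0 then Left else Stay)"
| "node_act K rs (Do InR) j = (rs ! j, if j = 0 then Right else Stay)"
| "node_act K rs (Do (Test a r)) j = (rs ! j, if j = Suc r \<and> a \<le> rs ! 0 then Right else Stay)"
| "node_act K rs (Do (Emit b)) j = (if j = Suc K then (bit_symbol b, Right) else (rs ! j, Stay))"
| "node_act K rs _ j = (rs ! j, Stay)"

text \<open>State \<open>0\<close> only writes the marks, so node \<open>i\<close> of the list is
  executed in state \<open>i + 1\<close>. The \<open>min\<close> keeps jump targets inside the state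
  range, which makes the machine well-formed for every node list.\<close>

definition machine :: "nat \<Rightarrow> node list \<Rightarrow> tm" where
  "machine K P = \<lparr>ntapes = K + 2, nstates = Suc (length P), nsymbols = 3,
     delta = (\<lambda>s rs. if s = 0
       then (1, map (\<lambda>j. (if 1 \<le> j \<and> j \<le> K then 1 else rs ! j, Stay)) [0..<K + 2])
       else (min (node_next s rs (P ! (s - 1))) (Suc (length P)),
             map (node_act K rs (P ! (s - 1))) [0..<K + 2]))\<rparr>"

lemma machine_sel [simp]:
  "ntapes (machine K P) = K + 2" "nstates (machine K P) = Suc (length P)"
  "nsymbols (machine K P) = 3"
  by (simp_all add: machine_def)

lemma node_act_bound:
  assumes "set rs \<subseteq> {..<3}" "j < length rs"
  shows "fst (node_act K rs nd j) < 3"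
proof -
  have "rs ! j < 3" using assms by (meson lessThan_iff nth_mem subsetD)
  then show ?thesis
    by (cases "(K, rs, nd, j)" rule: node_act.cases) (auto simp: bit_symbol_def)
qed

lemma wf_machine: "wf_tm (machine K P)"
proof -
  have "rs ! j < 3" if "set rs \<subseteq> {..<3}" "j < length rs" for rs :: "nat list" and j
    using that by (meson lessThan_iff nth_mem subsetD)
  then show ?thesis
    using node_act_bound unfolding wf_tm_def
    by (auto simp: machine_def simp del: upt_Suc)
qed

section \<open>Counters as head positions, and the effect of single machine steps\<close>

definition mark :: "int \<Rightarrow> nat" where
  "mark i = (if i = 0 then 1 else 0)"

text \<open>The output written so far looks like an input tape containing \<open>y\<close>, with the
  head on the first blank, so that \<open>Emit\<close> appends.\<close>

fun tapes :: "nat \<Rightarrow> bool list \<Rightarrow> store \<Rightarrow> tape list" where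
  "tapes K x (\<sigma>, h, y) =
     (in_sym x, h) # map (\<lambda>r. (mark, int (\<sigma> r))) [0..<K] @ [(in_sym y, int (length y))]"

lemma length_tapes [simp]: "length (tapes K x s) = K + 2"
  by (cases s) auto

lemma tapes_nth:
  "tapes K x (\<sigma>, h, y) ! 0 = (in_sym x, h)"
  "r < K \<Longrightarrow> tapes K x (\<sigma>, h, y) ! Suc r = (mark, int (\<sigma> r))"
  "tapes K x (\<sigma>, h, y) ! Suc K = (in_sym y, int (length y))"
  by (auto simp: nth_append)

lemma tape_cases:
  assumes "j < K + 2"
  obtains "j = 0" | r where "j = Suc r" "r < K" | "j = Suc K"
proof (cases j)
  case (Suc r)
  then show ?thesis using assms that by (cases "r < K") auto
qed (use that in auto)

lemma in_sym_snoc: "(in_sym y)(int (length y) := bit_symbol b) = in_sym (y @ [b])"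
  by (auto simp: input_tape_def fun_eq_iff nth_append nat_less_iff)

lemma map2_act_tapes:
  assumes len: "length ts = K + 2" "length ts' = K + 2"
    and step: "\<And>j. j < K + 2 \<Longrightarrow> act (A j) (ts ! j) = ts' ! j"
  shows "map2 act (map A [0..<K + 2]) ts = ts'"
  by (rule nth_equalityI) (use assms in \<open>auto simp del: upt_Suc act.simps\<close>)

lemma tm_step_machine:
  assumes "1 \<le> s" "s \<le> length P"
  shows "tm_step (machine K P) (s, ts) =
    (min (node_next s (map head_symbol ts) (P ! (s - 1))) (Suc (length P)),
     map2 act (map (node_act K (map head_symbol ts) (P ! (s - 1))) [0..<K + 2]) ts)"
  using assms by (auto simp: machine_def)

lemma read_tapes:
  "map head_symbol (tapes K x (\<sigma>, h, y)) ! 0 = in_sym x h"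
  "r < K \<Longrightarrow> map head_symbol (tapes K x (\<sigma>, h, y)) ! Suc r = mark (int (\<sigma> r))"
  "map head_symbol (tapes K x (\<sigma>, h, y)) ! Suc K = in_sym y (int (length y))"
  by (simp_all add: tapes_nth nth_append del: upt_Suc)

lemma node_act_prim:
  assumes "prim_regs p \<subseteq> {..<K}" "j < K + 2"
  shows "act (node_act K (map head_symbol (tapes K x s)) (Do p) j) (tapes K x s ! j)
    = tapes K x (prim_step x p s) ! j"
proof -
  obtain \<sigma> h y where s: "s = (\<sigma>, h, y)" by (cases s)
  show ?thesis
    using \<open>j < K + 2\<close>
  proof (cases rule: tape_cases)
    case 1
    then show ?thesis unfolding s using assms(1)
      by (cases p) (simp_all add: tapes_nth read_tapes del: tapes.simps)
  next
    case (2 r)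
    then show ?thesis unfolding s using assms(1)
      by (cases p) (auto simp: tapes_nth read_tapes mark_def fun_eq_iff simp del: tapes.simps)
  next
    case 3
    then show ?thesis unfolding s using assms(1)
      by (cases p) (auto simp: tapes_nth read_tapes in_sym_snoc simp del: tapes.simps)
  qed
qed

lemma tm_step_do:
  assumes "1 \<le> s" "s \<le> length P" "P ! (s - 1) = Do p" "prim_regs p \<subseteq> {..<K}"
  shows "tm_step (machine K P) (s, tapes K x st) = (Suc s, tapes K x (prim_step x p st))"
proof -
  have "map2 act (map (node_act K (map head_symbol (tapes K x st)) (Do p)) [0..<K + 2]) (tapes K x st)
     = tapes K x (prim_step x p st)"
    using node_act_prim[OF assms(4)] by (intro map2_act_tapes) simp_all
  then show ?thesis using assms by (simp add: tm_step_machine del: upt_Suc tm_step.simps)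
qed

lemma tm_step_stay:
  assumes "1 \<le> s" "s \<le> length P" "P ! (s - 1) = nd" "\<And>p. nd \<noteq> Do p"
  shows "tm_step (machine K P) (s, tapes K x st) =
    (min (node_next s (map head_symbol (tapes K x st)) nd) (Suc (length P)), tapes K x st)"
proof -
  have "map2 act (map (node_act K (map head_symbol (tapes K x st)) nd) [0..<K + 2]) (tapes K x st)
     = tapes K x st"
  proof (rule map2_act_tapes)
    fix j assume "j < K + 2"
    then show "act (node_act K (map head_symbol (tapes K x st)) nd j) (tapes K x st ! j) = tapes K x st ! j"
      using assms(4) by (cases nd; cases "tapes K x st ! j") (auto simp del: upt_Suc)
  qed simp_all
  then show ?thesis using assms by (simp add: tm_step_machine del: upt_Suc tm_step.simps)
qed

section \<open>Layout of compiled code and its simulation\<close>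

definition code_at :: "node list \<Rightarrow> nat \<Rightarrow> cmd \<Rightarrow> bool" where
  "code_at P n c \<longleftrightarrow> 1 \<le> n \<and> n + code_size c \<le> Suc (length P) \<and>
     (\<forall>i < code_size c. P ! (n + i - 1) = code n c ! i)"

lemma code_at_Seq:
  assumes "code_at P n (Seq c1 c2)"
  shows "code_at P n c1" "code_at P (n + code_size c1) c2"
proof -
  have *: "P ! (n + i - 1) = (code n c1 @ code (n + code_size c1) c2) ! i"
    if "i < code_size c1 + code_size c2" for i
    using assms that by (auto simp: code_at_def)
  show "code_at P n c1"
    using assms * by (auto simp: code_at_def nth_append)
  show "code_at P (n + code_size c1) c2"
    unfolding code_at_def
  proof (intro conjI allI impI)
    fix i assume "i < code_size c2"
    then show "P ! (n + code_size c1 + i - 1) = code (n + code_size c1) c2 ! i"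
      using *[of "code_size c1 + i"] by (simp add: nth_append add.assoc)
  qed (use assms in \<open>auto simp: code_at_def\<close>)
qed

lemma code_at_While:
  assumes "code_at P n (While r c)"
  shows "code_at P (Suc n) c" "P ! (n - 1) = Jz r (n + code_size c + 2)"
    "P ! (n + code_size c) = Jmp n"
proof -
  have *: "P ! (n + i - 1) = (Jz r (n + code_size c + 2) # code (Suc n) c @ [Jmp n]) ! i"
    if "i < code_size c + 2" for i
    using assms that by (auto simp: code_at_def)
  show "P ! (n - 1) = Jz r (n + code_size c + 2)" using *[of 0] by simp
  show "P ! (n + code_size c) = Jmp n"
    using *[of "Suc (code_size c)"] by (simp add: nth_append)
  show "code_at P (Suc n) c"
    unfolding code_at_def
  proof (intro conjI allI impI)
    fix i assume "i < code_size c"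
    then show "P ! (Suc n + i - 1) = code (Suc n) c ! i"
      using *[of "Suc i"] by (simp add: nth_append)
  qed (use assms in \<open>auto simp: code_at_def\<close>)
qed

lemma funpow_trans:
  "(f ^^ a) u = v \<Longrightarrow> (f ^^ b) v = w \<Longrightarrow> (f ^^ (a + b)) u = w"
  by (subst add.commute) (simp add: funpow_add)

lemma exec_machine:
  assumes "exec x c s s' t" "code_at P n c" "regs c \<subseteq> {..<K}"
  shows "(tm_step (machine K P) ^^ t) (n, tapes K x s) = (n + code_size c, tapes K x s')"
  using assms
proof (induction arbitrary: n rule: exec.induct)
  case (Prim p s)
  then have "P ! (n - 1) = Do p" "1 \<le> n" "n \<le> length P" by (auto simp: code_at_def)
  then show ?case using tm_step_do[of n P p K x s] Prim by (simp del: tm_step.simps)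
next
  case (Seq c1 s s1 t1 c2 s2 t2)
  then show ?case
    using code_at_Seq[OF Seq.prems(1)]
    by (intro funpow_trans[where v = "(n + code_size c1, tapes K x s1)"]) (auto simp: add.assoc)
next
  case (While0 s r c)
  have "map head_symbol (tapes K x s) ! Suc r = 1"
    using While0 read_tapes(2)[of r K x "fst s" "fst (snd s)" "snd (snd s)"]
    by (simp add: mark_def del: upt_Suc tapes.simps)
  moreover have "1 \<le> n" "n + code_size c + 2 \<le> Suc (length P)"
    using While0 by (auto simp: code_at_def)
  ultimately show ?case
    using code_at_While(2)[OF While0.prems(1)]
    by (simp add: tm_step_stay del: tm_step.simps)
next
  case (While1 s r c s1 t1 s2 t2)
  note ca = code_at_While[OF While1.prems(1)]
  have n: "1 \<le> n" "n + code_size c + 2 \<le> Suc (length P)"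
    using While1.prems by (auto simp: code_at_def)
  have "map head_symbol (tapes K x s) ! Suc r \<noteq> 1"
    using While1 read_tapes(2)[of r K x "fst s" "fst (snd s)" "snd (snd s)"]
    by (simp add: mark_def del: upt_Suc tapes.simps)
  then have 1: "(tm_step (machine K P) ^^ 1) (n, tapes K x s) = (Suc n, tapes K x s)"
    using ca(2) n by (simp add: tm_step_stay del: tm_step.simps)
  have 2: "(tm_step (machine K P) ^^ t1) (Suc n, tapes K x s) = (Suc n + code_size c, tapes K x s1)"
    using While1.IH(1) ca(1) While1.prems by auto
  have 3: "(tm_step (machine K P) ^^ 1) (Suc n + code_size c, tapes K x s1) = (n, tapes K x s1)"
    using ca(3) n by (simp add: tm_step_stay del: tm_step.simps)
  have 4: "(tm_step (machine K P) ^^ t2) (n, tapes K x s1) = (n + code_size (While r c), tapes K x s2)"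
    using While1.IH(2) While1.prems by auto
  from funpow_trans[OF funpow_trans[OF funpow_trans[OF 1 2] 3] 4]
  show ?case by (simp add: add_ac)
qed

lemma init_machine:
  "tm_step (machine K P) (init_config (machine K P) x) = (1, tapes K x (\<lambda>_. 0, 0, []))"
proof -
  have "map2 act (map (\<lambda>j. (if 1 \<le> j \<and> j \<le> K then 1 else
       map head_symbol (input_tape x # replicate (Suc K) blank_tape) ! j, Stay)) [0..<K + 2])
       (input_tape x # replicate (Suc K) blank_tape) = tapes K x (\<lambda>_. 0, 0, [])"
  proof (rule map2_act_tapes)
    fix j assume "j < K + 2"
    then show "act (if 1 \<le> j \<and> j \<le> K then 1 else
       map head_symbol (input_tape x # replicate (Suc K) blank_tape) ! j, Stay)
       ((input_tape x # replicate (Suc K) blank_tape) ! j) = tapes K x (\<lambda>_. 0, 0, []) ! j"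
      by (cases rule: tape_cases)
        (auto simp: tapes_nth blank_tape_def input_tape_def mark_def fun_eq_iff
           simp del: tapes.simps replicate_Suc)
  qed simp_all
  then show ?thesis
    by (simp add: init_config_def machine_def del: upt_Suc replicate_Suc list.map map_replicate tapes.simps)
qed

lemma poly_time_exec:
  assumes "\<And>x. \<exists>\<sigma> h t. t \<le> poly p (length x) \<and> exec x c (\<lambda>_. 0, 0, []) (\<sigma>, h, f x) t"
  shows "poly_time f"
proof -
  obtain K where K: "regs c \<subseteq> {..<K}"
    using finite_regs finite_nat_iff_bounded by blast
  define M where "M = machine K (code 1 c)"
  \<comment> \<open>The additional step is the initial one that marks the counter tapes.\<close>
  have "\<exists>t \<le> poly (p + 1) (length x). case (tm_step M ^^ t) (init_config M x) of (s, ts) \<Rightarrow>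
          s = nstates M \<and> holds_output (last ts) (f x)" for x
  proof -
    obtain \<sigma> h t where t: "t \<le> poly p (length x)" "exec x c (\<lambda>_. 0, 0, []) (\<sigma>, h, f x) t"
      using assms by blast
    have "code_at (code 1 c) 1 c" by (simp add: code_at_def)
    from exec_machine[OF t(2) this K]
    have 2: "(tm_step M ^^ t) (1, tapes K x (\<lambda>_. 0, 0, []))
      = (1 + code_size c, tapes K x (\<sigma>, h, f x))" by (simp add: M_def)
    have 1: "(tm_step M ^^ 1) (init_config M x) = (1, tapes K x (\<lambda>_. 0, 0, []))"
      by (simp add: M_def init_machine del: tm_step.simps tapes.simps)
    have "holds_output (in_sym (f x), int (length (f x))) (f x)"
      by (simp add: holds_output_def input_tape_def)
    with funpow_trans[OF 1 2] t(1) show ?thesis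
      by (intro exI[of _ "1 + t"]) (auto simp: M_def)
  qed
  then show ?thesis
    unfolding poly_time_def computes_in_time_def
    by (intro exI[of _ M] exI[of _ "p + 1"]) (auto simp: M_def wf_machine)
qed

section \<open>Timed runs\<close>

definition runs :: "bool list \<Rightarrow> cmd \<Rightarrow> store \<Rightarrow> store \<Rightarrow> nat \<Rightarrow> bool" where
  "runs x c s s' b \<longleftrightarrow> (\<exists>t\<le>b. exec x c s s' t)"

lemma runs_mono: "runs x c s s' b \<Longrightarrow> b \<le> b' \<Longrightarrow> runs x c s s' b'"
  by (auto simp: runs_def intro: order_trans)

lemma runs_Prim: "runs x (Prim p) s (prim_step x p s) 1"
  unfolding runs_def using exec.Prim by blast

lemma runs_Seq:
  assumes "runs x c1 s s1 b1" "runs x c2 s1 s2 b2"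
  shows "runs x (Seq c1 c2) s s2 (b1 + b2)"
proof -
  obtain t1 t2 where "t1 \<le> b1" "exec x c1 s s1 t1" "t2 \<le> b2" "exec x c2 s1 s2 t2"
    using assms by (auto simp: runs_def)
  then show ?thesis unfolding runs_def
    by (intro exI[of _ "t1 + t2"] conjI exec.Seq[of x c1 s s1]) auto
qed

text \<open>A loop is described by its whole trajectory \<open>S 0\<close>, ..., \<open>S n\<close>,
  so that an explicit formula for the store after \<open>i\<close> rounds replaces an
  invariant.\<close>

lemma runs_While:
  assumes "\<And>i. i < n \<Longrightarrow> fst (S i) r \<noteq> 0" "\<And>i. i < n \<Longrightarrow> runs x c (S i) (S (Suc i)) b"
    and "fst (S n) r = 0"
  shows "runs x (While r c) (S 0) (S n) (n * (b + 2) + 1)"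
  using assms
proof (induction n arbitrary: S)
  case 0
  then show ?case by (auto simp: runs_def intro!: exI[of _ 1] exec.While0)
next
  case (Suc n)
  have "runs x (While r c) (S 1) (S (Suc n)) (n * (b + 2) + 1)"
    using Suc.IH[of "\<lambda>i. S (Suc i)"] Suc.prems by auto
  then obtain t2 where t2: "t2 \<le> n * (b + 2) + 1" "exec x (While r c) (S 1) (S (Suc n)) t2"
    by (auto simp: runs_def)
  obtain t1 where t1: "t1 \<le> b" "exec x c (S 0) (S 1) t1"
    using Suc.prems(2)[of 0] by (auto simp: runs_def)
  have "exec x (While r c) (S 0) (S (Suc n)) (t1 + t2 + 2)"
    using exec.While1[of "S 0" r x c "S 1" t1 "S (Suc n)" t2] Suc.prems(1)[of 0] t1 t2 by simp
  then show ?case using t1 t2 unfolding runs_def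
    by (intro exI[of _ "t1 + t2 + 2"]) auto
qed

fun block :: "prim list \<Rightarrow> cmd" where
  "block [] = undefined"
| "block [p] = Prim p"
| "block (p # ps) = Seq (Prim p) (block ps)"

lemma runs_block: "ps \<noteq> [] \<Longrightarrow> runs x (block ps) s (fold (prim_step x) ps s) (length ps)"
proof (induction ps arbitrary: s rule: block.induct)
  case (2 p)
  then show ?case using runs_Prim by simp
next
  case (3 p q ps)
  then show ?case using runs_Seq[OF runs_Prim 3(1)] by simp
qed simp

lemma runs_While_block:
  assumes "\<And>i. i < n \<Longrightarrow> fst (S i) r \<noteq> 0"
    and "\<And>i. i < n \<Longrightarrow> fold (prim_step x) ps (S i) = S (Suc i)"
    and "fst (S n) r = 0" "ps \<noteq> []" "S 0 = s" "S n = s'"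
  shows "runs x (While r (block ps)) s s' (n * (length ps + 2) + 1)"
  using runs_While[of n S r x "block ps" "length ps"] runs_block[OF assms(4), of x] assms by metis

section \<open>Bounded arithmetic\<close>

text \<open>
  A function of the input word and of an environment of natural numbers. Every value is bounded by a
  polynomial, which is what makes unary counters affordable.
\<close>

inductive barith :: "(bool list \<Rightarrow> (nat \<Rightarrow> nat) \<Rightarrow> nat) \<Rightarrow> bool" where
  one: "barith (\<lambda>x e. 1)"
| len: "barith (\<lambda>x e. length x)"
| bit: "barith f \<Longrightarrow> barith (\<lambda>x e. of_bool (f x e < length x \<and> x ! f x e))"
| var: "barith (\<lambda>x e. e 0)"
| weaken: "barith f \<Longrightarrow> barith (\<lambda>x e. f x (\<lambda>i. e (Suc i)))"
| add: "barith f \<Longrightarrow> barith g \<Longrightarrow> barith (\<lambda>x e. f x e + g x e)"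
| diff: "barith f \<Longrightarrow> barith g \<Longrightarrow> barith (\<lambda>x e. f x e - g x e)"
| sum: "barith f \<Longrightarrow> barith g \<Longrightarrow> barith (\<lambda>x e. \<Sum>i<f x e. g x (case_nat i e))"

definition bounded_by :: "(bool list \<Rightarrow> (nat \<Rightarrow> nat) \<Rightarrow> nat) \<Rightarrow> nat poly \<Rightarrow> bool" where
  "bounded_by f p \<longleftrightarrow> (\<forall>x e m. length x \<le> m \<and> (\<forall>i. e i \<le> m) \<longrightarrow> f x e \<le> poly p m)"

text \<open>Adding to \<open>d\<close> instead of overwriting it turns sums into repetition.
  Variable \<open>i\<close> lives in register \<open>\<rho> i\<close>. The registers from
  \<open>k\<close> on are scratch space, found and left at zero, and the input head starts and ends
  at cell \<open>0\<close>.\<close>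

definition adds :: "(bool list \<Rightarrow> (nat \<Rightarrow> nat) \<Rightarrow> nat) \<Rightarrow> (nat \<Rightarrow> nat) \<Rightarrow> nat \<Rightarrow> nat \<Rightarrow> nat poly \<Rightarrow> cmd \<Rightarrow> bool"
  where "adds f \<rho> k d p c \<longleftrightarrow> (\<forall>x \<sigma> y m. length x \<le> m \<and> (\<forall>i. \<sigma> (\<rho> i) \<le> m) \<and> (\<forall>r\<ge>k. \<sigma> r = 0) \<longrightarrow>
     runs x c (\<sigma>, 0, y) (\<sigma>(d := \<sigma> d + f x (\<lambda>i. \<sigma> (\<rho> i))), 0, y) (poly p m))"

text \<open>The bound on the value is carried along because values determine how often loops run;
  \<open>\<rho> i \<noteq> d\<close> keeps the growing result from changing a variable.\<close>

definition realizable :: "(bool list \<Rightarrow> (nat \<Rightarrow> nat) \<Rightarrow> nat) \<Rightarrow> bool" where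
  "realizable f \<longleftrightarrow> (\<exists>p. bounded_by f p) \<and>
     (\<exists>p. \<forall>\<rho> k d. (\<forall>i. \<rho> i < k \<and> \<rho> i \<noteq> d) \<and> d < k \<longrightarrow> (\<exists>c. adds f \<rho> k d p c))"

lemma realizableI:
  assumes "bounded_by f q"
    and "\<And>\<rho> k d. \<forall>i. \<rho> i < k \<and> \<rho> i \<noteq> d \<Longrightarrow> d < k \<Longrightarrow> \<exists>c. adds f \<rho> k d p c"
  shows "realizable f"
  unfolding realizable_def using assms by blast

lemma addsD:
  assumes "adds f \<rho> k d p c" "length x \<le> m" "\<And>i. \<sigma> (\<rho> i) \<le> m" "\<And>r. k \<le> r \<Longrightarrow> \<sigma> r = 0"
    and "\<sigma>' = \<sigma>(d := \<sigma> d + f x (\<lambda>i. \<sigma> (\<rho> i)))"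
  shows "runs x c (\<sigma>, 0, y) (\<sigma>', 0, y) (poly p m)"
  using assms unfolding adds_def by blast

lemma poly_nat_mono: "m \<le> n \<Longrightarrow> poly p m \<le> poly p (n :: nat)"
  by (induction p) (auto intro!: add_mono mult_mono)

lemma bounded_byD:
  "bounded_by f p \<Longrightarrow> length x \<le> m \<Longrightarrow> (\<And>i. e i \<le> m) \<Longrightarrow> f x e \<le> poly p m"
  by (auto simp: bounded_by_def)

lemma realizable_one: "realizable (\<lambda>x e. 1)"
proof (rule realizableI)
  show "bounded_by (\<lambda>x e. 1) 1" by (simp add: bounded_by_def)
  fix \<rho> :: "nat \<Rightarrow> nat" and k d
  show "\<exists>c. adds (\<lambda>x e. 1) \<rho> k d 1 c"
    unfolding adds_def using runs_Prim[of _ "Inc d"] by (intro exI[of _ "Prim (Inc d)"]) auto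
qed

lemma realizable_var: "realizable (\<lambda>x e. e 0)"
proof (rule realizableI)
  show "bounded_by (\<lambda>x e. e 0) [:0, 1:]" by (simp add: bounded_by_def)
  fix \<rho> :: "nat \<Rightarrow> nat" and k d
  assume \<rho>: "\<forall>i. \<rho> i < k \<and> \<rho> i \<noteq> d" and d: "d < k"
  let ?r = "\<rho> 0"
  have ne: "?r \<noteq> d" "d \<noteq> ?r" "?r \<noteq> k" "k \<noteq> ?r" "d \<noteq> k" "k \<noteq> d"
    using \<rho> d by (auto dest: spec[of _ 0])
  \<comment> \<open>A counter is copied by emptying it: its content goes to \<open>d\<close> and to
    the scratch register \<open>k\<close>, from which it is then restored.\<close>
  let ?c = "Seq (While ?r (block [Dec ?r, Inc d, Inc k])) (While k (block [Dec k, Inc ?r]))"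
  have "adds (\<lambda>x e. e 0) \<rho> k d [:2, 9:] ?c"
    unfolding adds_def
  proof (intro allI impI, elim conjE)
    fix x \<sigma> y m
    assume m: "length (x :: bool list) \<le> m" "\<forall>i. \<sigma> (\<rho> i) \<le> m" "\<forall>r\<ge>k. \<sigma> r = 0"
    let ?n = "\<sigma> ?r"
    have 1: "runs x (While ?r (block [Dec ?r, Inc d, Inc k])) (\<sigma>, 0, y)
        (\<sigma>(?r := 0, d := \<sigma> d + ?n, k := ?n), 0, y) (?n * (length [Dec ?r, Inc d, Inc k] + 2) + 1)"
      by (rule runs_While_block[where S = "\<lambda>i. (\<sigma>(?r := ?n - i, d := \<sigma> d + i, k := i), 0, y)"])
        (use m ne in \<open>auto simp: fun_eq_iff\<close>)
    have 2: "runs x (While k (block [Dec k, Inc ?r])) (\<sigma>(?r := 0, d := \<sigma> d + ?n, k := ?n), 0, y)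
        (\<sigma>(d := \<sigma> d + ?n), 0, y) (?n * (length [Dec k, Inc ?r] + 2) + 1)"
      by (rule runs_While_block[where S = "\<lambda>i. (\<sigma>(?r := i, d := \<sigma> d + ?n, k := ?n - i), 0, y)"])
        (use m ne in \<open>auto simp: fun_eq_iff\<close>)
    show "runs x ?c (\<sigma>, 0, y) (\<sigma>(d := \<sigma> d + \<sigma> (\<rho> 0)), 0, y) (poly [:2, 9:] m)"
      by (rule runs_mono[OF runs_Seq[OF 1 2]]) (use m(2)[rule_format, of 0] in \<open>simp\<close>)
  qed
  then show "\<exists>c. adds (\<lambda>x e. e 0) \<rho> k d [:2, 9:] c" by blast
qed

lemma realizable_weaken:
  assumes "realizable f"
  shows "realizable (\<lambda>x e. f x (\<lambda>i. e (Suc i)))"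
proof -
  obtain q p where q: "bounded_by f q"
    and p: "\<And>\<rho> k d. \<forall>i. \<rho> i < k \<and> \<rho> i \<noteq> d \<Longrightarrow> d < k \<Longrightarrow> \<exists>c. adds f \<rho> k d p c"
    using assms unfolding realizable_def by blast
  show ?thesis
  proof (rule realizableI)
    show "bounded_by (\<lambda>x e. f x (\<lambda>i. e (Suc i))) q" using q by (auto simp: bounded_by_def)
    fix \<rho> :: "nat \<Rightarrow> nat" and k d
    assume "\<forall>i. \<rho> i < k \<and> \<rho> i \<noteq> d" "d < k"
    then obtain c where c: "adds f (\<lambda>i. \<rho> (Suc i)) k d p c"
      using p[of "\<lambda>i. \<rho> (Suc i)" k d] by auto
    have "adds (\<lambda>x e. f x (\<lambda>i. e (Suc i))) \<rho> k d p c"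
      using c unfolding adds_def by auto
    then show "\<exists>c. adds (\<lambda>x e. f x (\<lambda>i. e (Suc i))) \<rho> k d p c" by blast
  qed
qed

lemma realizable_add:
  assumes "realizable f" "realizable g"
  shows "realizable (\<lambda>x e. f x e + g x e)"
proof -
  obtain q p where q: "bounded_by f q"
    and p: "\<And>\<rho> k d. \<forall>i. \<rho> i < k \<and> \<rho> i \<noteq> d \<Longrightarrow> d < k \<Longrightarrow> \<exists>c. adds f \<rho> k d p c"
    using assms(1) unfolding realizable_def by blast
  obtain q' p' where q': "bounded_by g q'"
    and p': "\<And>\<rho> k d. \<forall>i. \<rho> i < k \<and> \<rho> i \<noteq> d \<Longrightarrow> d < k \<Longrightarrow> \<exists>c. adds g \<rho> k d p' c"
    using assms(2) unfolding realizable_def by blast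
  show ?thesis
  proof (rule realizableI)
    show "bounded_by (\<lambda>x e. f x e + g x e) (q + q')"
      using q q' by (auto simp: bounded_by_def intro!: add_mono)
    fix \<rho> :: "nat \<Rightarrow> nat" and k d
    assume \<rho>: "\<forall>i. \<rho> i < k \<and> \<rho> i \<noteq> d" and d: "d < k"
    obtain c c' where c: "adds f \<rho> k d p c" and c': "adds g \<rho> k d p' c'"
      using p p' \<rho> d by metis
    have ne: "\<rho> i \<noteq> d" for i using \<rho> by auto
    have "adds (\<lambda>x e. f x e + g x e) \<rho> k d (p + p') (Seq c c')"
      unfolding adds_def
    proof (intro allI impI, elim conjE)
      fix x \<sigma> y m
      assume m: "length (x :: bool list) \<le> m" "\<forall>i. \<sigma> (\<rho> i) \<le> m" "\<forall>r\<ge>k. \<sigma> r = 0"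
      let ?e = "\<lambda>i. \<sigma> (\<rho> i)"
      have 1: "runs x c (\<sigma>, 0, y) (\<sigma>(d := \<sigma> d + f x ?e), 0, y) (poly p m)"
        by (rule addsD[OF c]) (use m in auto)
      have 2: "runs x c' (\<sigma>(d := \<sigma> d + f x ?e), 0, y)
          (\<sigma>(d := \<sigma> d + (f x ?e + g x ?e)), 0, y) (poly p' m)"
        by (rule addsD[OF c']) (use m ne d in auto)
      show "runs x (Seq c c') (\<sigma>, 0, y) (\<sigma>(d := \<sigma> d + (f x ?e + g x ?e)), 0, y) (poly (p + p') m)"
        by (rule runs_mono[OF runs_Seq[OF 1 2]]) simp
    qed
    then show "\<exists>c. adds (\<lambda>x e. f x e + g x e) \<rho> k d (p + p') c" by blast
  qed
qed

lemma realizable_diff: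
  assumes "realizable f" "realizable g"
  shows "realizable (\<lambda>x e. f x e - g x e)"
proof -
  obtain q p where q: "bounded_by f q"
    and p: "\<And>\<rho> k d. \<forall>i. \<rho> i < k \<and> \<rho> i \<noteq> d \<Longrightarrow> d < k \<Longrightarrow> \<exists>c. adds f \<rho> k d p c"
    using assms(1) unfolding realizable_def by blast
  obtain q' p' where q': "bounded_by g q'"
    and p': "\<And>\<rho> k d. \<forall>i. \<rho> i < k \<and> \<rho> i \<noteq> d \<Longrightarrow> d < k \<Longrightarrow> \<exists>c. adds g \<rho> k d p' c"
    using assms(2) unfolding realizable_def by blast
  show ?thesis
  proof (rule realizableI)
    show "bounded_by (\<lambda>x e. f x e - g x e) q"
      using q by (auto simp: bounded_by_def intro: le_trans[OF diff_le_self])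
    fix \<rho> :: "nat \<Rightarrow> nat" and k d
    assume \<rho>: "\<forall>i. \<rho> i < k \<and> \<rho> i \<noteq> d" and d: "d < k"
    have less: "\<rho> i < k" for i using \<rho> by auto
    have ne: "\<rho> i \<noteq> d" "\<rho> i \<noteq> k" "\<rho> i \<noteq> Suc k" for i
      using \<rho>[rule_format, of i] by auto
    have "\<exists>c. adds f \<rho> (k + 2) k p c"
      by (rule p) (use less ne in \<open>auto simp: less_Suc_eq\<close>)
    moreover have "\<exists>c. adds g \<rho> (k + 2) (Suc k) p' c"
      by (rule p') (use less ne in \<open>auto simp: less_Suc_eq\<close>)
    ultimately obtain c c' where c: "adds f \<rho> (k + 2) k p c" and c': "adds g \<rho> (k + 2) (Suc k) p' c'"
      by blast
    \<comment> \<open>\<open>Dec\<close> stops at zero, so decrementing \<open>k\<close> once for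
      each unit of \<open>Suc k\<close> is exactly truncated subtraction.\<close>
    let ?c = "Seq (Seq c c') (Seq (While (Suc k) (block [Dec (Suc k), Dec k])) (While k (block [Dec k, Inc d])))"
    let ?p = "p + p' + smult 4 q' + smult 4 q + 2"
    have "adds (\<lambda>x e. f x e - g x e) \<rho> k d ?p ?c"
      unfolding adds_def
    proof (intro allI impI, elim conjE)
      fix x \<sigma> y m
      assume m: "length (x :: bool list) \<le> m" "\<forall>i. \<sigma> (\<rho> i) \<le> m" "\<forall>r\<ge>k. \<sigma> r = 0"
      let ?e = "\<lambda>i. \<sigma> (\<rho> i)"
      let ?F = "f x ?e" and ?G = "g x ?e"
      have 1: "runs x c (\<sigma>, 0, y) (\<sigma>(k := ?F), 0, y) (poly p m)"
        by (rule addsD[OF c]) (use m in auto)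
      have 2: "runs x c' (\<sigma>(k := ?F), 0, y) (\<sigma>(k := ?F, Suc k := ?G), 0, y) (poly p' m)"
        by (rule addsD[OF c']) (use m ne d in auto)
      have 3: "runs x (While (Suc k) (block [Dec (Suc k), Dec k])) (\<sigma>(k := ?F, Suc k := ?G), 0, y)
          (\<sigma>(k := ?F - ?G), 0, y) (?G * (length [Dec (Suc k), Dec k] + 2) + 1)"
        by (rule runs_While_block[where S = "\<lambda>i. (\<sigma>(k := ?F - i, Suc k := ?G - i), 0, y)"])
          (use m in \<open>auto simp: fun_eq_iff\<close>)
      have 4: "runs x (While k (block [Dec k, Inc d])) (\<sigma>(k := ?F - ?G), 0, y)
          (\<sigma>(d := \<sigma> d + (?F - ?G)), 0, y) ((?F - ?G) * (length [Dec k, Inc d] + 2) + 1)"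
        by (rule runs_While_block[where S = "\<lambda>i. (\<sigma>(k := ?F - ?G - i, d := \<sigma> d + i), 0, y)"])
          (use m d in \<open>auto simp: fun_eq_iff\<close>)
      have b: "?F \<le> poly q m" "?G \<le> poly q' m"
        using bounded_byD[OF q] bounded_byD[OF q'] m by auto
      show "runs x ?c (\<sigma>, 0, y) (\<sigma>(d := \<sigma> d + (?F - ?G)), 0, y) (poly ?p m)"
        by (rule runs_mono[OF runs_Seq[OF runs_Seq[OF 1 2] runs_Seq[OF 3 4]]]) (use b in simp)
    qed
    then show "\<exists>c. adds (\<lambda>x e. f x e - g x e) \<rho> k d ?p c" by blast
  qed
qed

lemma realizable_len: "realizable (\<lambda>x e. length x)"
proof (rule realizableI)
  show "bounded_by (\<lambda>x e. length x) [:0, 1:]" by (simp add: bounded_by_def)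
  fix \<rho> :: "nat \<Rightarrow> nat" and k d
  assume \<rho>: "\<forall>i. \<rho> i < k \<and> \<rho> i \<noteq> d" and d: "d < k"
  \<comment> \<open>\<open>Suc k\<close> is a flag telling whether the head is on a nonblank cell;
    \<open>k\<close> counts the moves, so that the head can find its way back.\<close>
  let ?ps = "[Dec (Suc k), Inc d, Inc k, InR, Test 1 (Suc k)]"
  let ?c = "Seq (Prim (Test 1 (Suc k))) (Seq (While (Suc k) (block ?ps)) (While k (block [Dec k, InL])))"
  have "adds (\<lambda>x e. length x) \<rho> k d [:3, 11:] ?c"
    unfolding adds_def
  proof (intro allI impI, elim conjE)
    fix x \<sigma> y m
    assume m: "length (x :: bool list) \<le> m" "\<forall>i. \<sigma> (\<rho> i) \<le> m" "\<forall>r\<ge>k. \<sigma> r = 0"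
    let ?n = "length x"
    have test: "of_bool (Suc 0 \<le> in_sym x (int i)) = (of_bool (i < ?n) :: nat)" for i
      by (auto simp: input_tape_def bit_symbol_def)
    have 1: "runs x (Prim (Test 1 (Suc k))) (\<sigma>, 0, y) (\<sigma>(Suc k := of_bool (0 < ?n)), 0, y) 1"
      using runs_Prim[of x "Test 1 (Suc k)" "(\<sigma>, 0, y)"] m test[of 0] by simp
    have 2: "runs x (While (Suc k) (block ?ps)) (\<sigma>(Suc k := of_bool (0 < ?n)), 0, y)
        (\<sigma>(d := \<sigma> d + ?n, k := ?n), int ?n, y) (?n * (length ?ps + 2) + 1)"
      by (rule runs_While_block[where
            S = "\<lambda>i. (\<sigma>(d := \<sigma> d + i, k := i, Suc k := of_bool (i < ?n)), int i, y)"])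
        (use m d test[of "Suc _"] in \<open>auto simp: fun_eq_iff add.commute\<close>)
    have 3: "runs x (While k (block [Dec k, InL])) (\<sigma>(d := \<sigma> d + ?n, k := ?n), int ?n, y)
        (\<sigma>(d := \<sigma> d + ?n), 0, y) (?n * (length [Dec k, InL] + 2) + 1)"
      by (rule runs_While_block[where
            S = "\<lambda>i. (\<sigma>(d := \<sigma> d + ?n, k := ?n - i), int ?n - int i, y)"])
        (use m d in \<open>auto simp: fun_eq_iff\<close>)
    show "runs x ?c (\<sigma>, 0, y) (\<sigma>(d := \<sigma> d + ?n), 0, y) (poly [:3, 11:] m)"
      by (rule runs_mono[OF runs_Seq[OF 1 runs_Seq[OF 2 3]]]) (use m in simp)
  qed
  then show "\<exists>c. adds (\<lambda>x e. length x) \<rho> k d [:3, 11:] c" by blast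
qed

lemma realizable_bit:
  assumes "realizable f"
  shows "realizable (\<lambda>x e. of_bool (f x e < length x \<and> x ! f x e))"
proof -
  obtain q p where q: "bounded_by f q"
    and p: "\<And>\<rho> k d. \<forall>i. \<rho> i < k \<and> \<rho> i \<noteq> d \<Longrightarrow> d < k \<Longrightarrow> \<exists>c. adds f \<rho> k d p c"
    using assms unfolding realizable_def by blast
  show ?thesis
  proof (rule realizableI)
    show "bounded_by (\<lambda>x e. of_bool (f x e < length x \<and> x ! f x e)) 1"
      by (simp add: bounded_by_def)
    fix \<rho> :: "nat \<Rightarrow> nat" and k d
    assume \<rho>: "\<forall>i. \<rho> i < k \<and> \<rho> i \<noteq> d" and d: "d < k"
    have less: "\<rho> i < k" for i using \<rho> by auto
    have ne: "\<rho> i \<noteq> k" for i using \<rho>[rule_format, of i] by auto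
    have "\<exists>c. adds f \<rho> (k + 2) k p c"
      by (rule p) (use less ne in \<open>auto simp: less_Suc_eq\<close>)
    then obtain c where c: "adds f \<rho> (k + 2) k p c" by blast
    let ?c = "Seq (Seq c (While k (block [Dec k, Inc (Suc k), InR])))
      (Seq (Prim (Test 2 d)) (While (Suc k) (block [Dec (Suc k), InL])))"
    let ?p = "p + smult 9 q + 3"
    have "adds (\<lambda>x e. of_bool (f x e < length x \<and> x ! f x e)) \<rho> k d ?p ?c"
      unfolding adds_def
    proof (intro allI impI, elim conjE)
      fix x \<sigma> y m
      assume m: "length (x :: bool list) \<le> m" "\<forall>i. \<sigma> (\<rho> i) \<le> m" "\<forall>r\<ge>k. \<sigma> r = 0"
      let ?F = "f x (\<lambda>i. \<sigma> (\<rho> i))"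
      let ?v = "of_bool (?F < length x \<and> x ! ?F) :: nat"
      \<comment> \<open>Symbol \<open>2\<close> stands for \<open>True\<close> and the cells past
        the input are blank, so one comparison covers both the bit and the range check.\<close>
      have test: "of_bool (2 \<le> in_sym x (int ?F)) = ?v"
        by (auto simp: input_tape_def bit_symbol_def)
      have 1: "runs x c (\<sigma>, 0, y) (\<sigma>(k := ?F), 0, y) (poly p m)"
        by (rule addsD[OF c]) (use m in auto)
      have 2: "runs x (While k (block [Dec k, Inc (Suc k), InR])) (\<sigma>(k := ?F), 0, y)
          (\<sigma>(Suc k := ?F), int ?F, y) (?F * (length [Dec k, Inc (Suc k), InR] + 2) + 1)"
        by (rule runs_While_block[where S = "\<lambda>i. (\<sigma>(k := ?F - i, Suc k := i), int i, y)"])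
          (use m in \<open>auto simp: fun_eq_iff add.commute\<close>)
      have 3: "runs x (Prim (Test 2 d)) (\<sigma>(Suc k := ?F), int ?F, y)
          (\<sigma>(Suc k := ?F, d := \<sigma> d + ?v), int ?F, y) 1"
        using runs_Prim[of x "Test 2 d" "(\<sigma>(Suc k := ?F), int ?F, y)"] d test by simp
      have 4: "runs x (While (Suc k) (block [Dec (Suc k), InL])) (\<sigma>(Suc k := ?F, d := \<sigma> d + ?v), int ?F, y)
          (\<sigma>(d := \<sigma> d + ?v), 0, y) (?F * (length [Dec (Suc k), InL] + 2) + 1)"
        by (rule runs_While_block[where
              S = "\<lambda>i. (\<sigma>(Suc k := ?F - i, d := \<sigma> d + ?v), int ?F - int i, y)"])
          (use m d in \<open>auto simp: fun_eq_iff\<close>)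
      have b: "?F \<le> poly q m"
        using bounded_byD[OF q] m by auto
      show "runs x ?c (\<sigma>, 0, y) (\<sigma>(d := \<sigma> d + ?v), 0, y) (poly ?p m)"
        by (rule runs_mono[OF runs_Seq[OF runs_Seq[OF 1 2] runs_Seq[OF 3 4]]]) (use b in simp)
    qed
    then show "\<exists>c. adds (\<lambda>x e. of_bool (f x e < length x \<and> x ! f x e)) \<rho> k d ?p c" by blast
  qed
qed

lemma realizable_sum:
  assumes "realizable f" "realizable g"
  shows "realizable (\<lambda>x e. \<Sum>i<f x e. g x (case_nat i e))"
proof -
  obtain q p where q: "bounded_by f q"
    and p: "\<And>\<rho> k d. \<forall>i. \<rho> i < k \<and> \<rho> i \<noteq> d \<Longrightarrow> d < k \<Longrightarrow> \<exists>c. adds f \<rho> k d p c"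
    using assms(1) unfolding realizable_def by blast
  obtain q' p' where q': "bounded_by g q'"
    and p': "\<And>\<rho> k d. \<forall>i. \<rho> i < k \<and> \<rho> i \<noteq> d \<Longrightarrow> d < k \<Longrightarrow> \<exists>c. adds g \<rho> k d p' c"
    using assms(2) unfolding realizable_def by blast
  \<comment> \<open>The summation index is a further variable of \<open>g\<close>; being below
    \<open>poly q m\<close>, it leaves the extended environment bounded by
    \<open>m + poly q m\<close>.\<close>
  let ?X = "[:0, 1:] + q"
  show ?thesis
  proof (rule realizableI)
    show "bounded_by (\<lambda>x e. \<Sum>i<f x e. g x (case_nat i e)) (q * (q' \<circ>\<^sub>p ?X))"
      unfolding bounded_by_def
    proof (intro allI impI, elim conjE)
      fix x and e :: "nat \<Rightarrow> nat" and m
      assume m: "length (x :: bool list) \<le> m" "\<forall>i. e i \<le> m"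
      have F: "f x e \<le> poly q m" using bounded_byD[OF q] m by auto
      have "g x (case_nat i e) \<le> poly q' (m + poly q m)" if "i < f x e" for i
        by (rule bounded_byD[OF q']) (use m F that in \<open>auto split: nat.split intro: trans_le_add1\<close>)
      then have "(\<Sum>i<f x e. g x (case_nat i e)) \<le> (\<Sum>i<f x e. poly q' (m + poly q m))"
        by (intro sum_mono) simp
      also have "\<dots> \<le> poly q m * poly q' (m + poly q m)" using F by simp
      finally show "(\<Sum>i<f x e. g x (case_nat i e)) \<le> poly (q * (q' \<circ>\<^sub>p ?X)) m"
        by (simp add: poly_pcompose)
    qed
    fix \<rho> :: "nat \<Rightarrow> nat" and k d
    assume \<rho>: "\<forall>i. \<rho> i < k \<and> \<rho> i \<noteq> d" and d: "d < k"
    have less: "\<rho> i < k" for i using \<rho> by auto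
    have ne: "\<rho> i \<noteq> d" "\<rho> i \<noteq> k" "\<rho> i \<noteq> Suc k" for i
      using \<rho>[rule_format, of i] by auto
    have "\<exists>c. adds f \<rho> (k + 2) k p c"
      by (rule p) (use less ne in \<open>auto simp: less_Suc_eq\<close>)
    moreover have "\<exists>c. adds g (case_nat (Suc k) \<rho>) (k + 2) d p' c"
      by (rule p') (use less ne d in \<open>auto simp: less_Suc_eq split: nat.split\<close>)
    ultimately obtain c c' where c: "adds f \<rho> (k + 2) k p c"
      and c': "adds g (case_nat (Suc k) \<rho>) (k + 2) d p' c'" by blast
    \<comment> \<open>\<open>k\<close> counts the remaining rounds down while \<open>Suc k\<close>
      counts up and serves as the bound variable; all rounds accumulate into the same
      \<open>d\<close>.\<close>
    let ?b = "Seq (Prim (Dec k)) (Seq c' (Prim (Inc (Suc k))))"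
    let ?c = "Seq c (Seq (While k ?b) (While (Suc k) (block [Dec (Suc k)])))"
    let ?p = "p + q * ((p' \<circ>\<^sub>p ?X) + 4) + smult 3 q + 2"
    have "adds (\<lambda>x e. \<Sum>i<f x e. g x (case_nat i e)) \<rho> k d ?p ?c"
      unfolding adds_def
    proof (intro allI impI, elim conjE)
      fix x \<sigma> y m
      assume m: "length (x :: bool list) \<le> m" "\<forall>i. \<sigma> (\<rho> i) \<le> m" "\<forall>r\<ge>k. \<sigma> r = 0"
      let ?e = "\<lambda>i. \<sigma> (\<rho> i)"
      let ?F = "f x ?e" and ?G = "\<lambda>i. g x (case_nat i ?e)"
      have b: "?F \<le> poly q m" using bounded_byD[OF q] m by auto
      have 1: "runs x c (\<sigma>, 0, y) (\<sigma>(k := ?F), 0, y) (poly p m)"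
        by (rule addsD[OF c]) (use m in auto)
      define S where "S = (\<lambda>i. (\<sigma>(k := ?F - i, Suc k := i, d := \<sigma> d + (\<Sum>j<i. ?G j)), 0 :: int, y))"
      have body: "runs x ?b (S i) (S (Suc i)) (poly p' (m + poly q m) + 2)" if i: "i < ?F" for i
      proof -
        let ?\<sigma> = "\<sigma>(k := ?F - Suc i, Suc k := i, d := \<sigma> d + (\<Sum>j<i. ?G j))"
        have 1: "runs x (Prim (Dec k)) (S i) (?\<sigma>, 0, y) 1"
          using runs_Prim[of x "Dec k" "S i"] d by (simp add: S_def fun_upd_twist)
        have env: "(\<lambda>j. ?\<sigma> (case_nat (Suc k) \<rho> j)) = case_nat i ?e"
          using ne d by (auto simp: fun_eq_iff split: nat.split)
        have 2: "runs x c' (?\<sigma>, 0, y) (?\<sigma>(d := ?\<sigma> d + ?G i), 0, y) (poly p' (m + poly q m))"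
        proof (rule addsD[OF c'])
          show "?\<sigma> (case_nat (Suc k) \<rho> j) \<le> m + poly q m" for j
            using fun_cong[OF env, of j] m b i by (auto split: nat.split intro: trans_le_add1)
          show "?\<sigma>(d := ?\<sigma> d + ?G i) = ?\<sigma>(d := ?\<sigma> d + g x (\<lambda>j. ?\<sigma> (case_nat (Suc k) \<rho> j)))"
            unfolding env ..
        qed (use m d in auto)
        have 3: "runs x (Prim (Inc (Suc k))) (?\<sigma>(d := ?\<sigma> d + ?G i), 0, y) (S (Suc i)) 1"
          using runs_Prim[of x "Inc (Suc k)" "(?\<sigma>(d := ?\<sigma> d + ?G i), 0, y)"] d
          by (simp add: S_def fun_upd_twist add.assoc)
        show ?thesis
          by (rule runs_mono[OF runs_Seq[OF 1 runs_Seq[OF 2 3]]]) simp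
      qed
      have S0: "S 0 = (\<sigma>(k := ?F), 0, y)" using m d by (auto simp: S_def fun_eq_iff)
      have 2: "runs x (While k ?b) (S 0) (S ?F) (?F * (poly p' (m + poly q m) + 2 + 2) + 1)"
        by (rule runs_While) (use body d in \<open>auto simp: S_def\<close>)
      have 3: "runs x (While (Suc k) (block [Dec (Suc k)])) (S ?F)
          (\<sigma>(d := \<sigma> d + (\<Sum>i<?F. ?G i)), 0, y) (?F * (length [Dec (Suc k)] + 2) + 1)"
        by (rule runs_While_block[where S = "\<lambda>i. (\<sigma>(Suc k := ?F - i, d := \<sigma> d + (\<Sum>i<?F. ?G i)), 0, y)"])
          (use m d in \<open>auto simp: fun_eq_iff S_def\<close>)
      have "poly p m + (?F * (poly p' (m + poly q m) + 2 + 2) + 1 + (?F * (length [Dec (Suc k)] + 2) + 1))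
          \<le> poly ?p m"
      proof -
        have "?F * (poly p' (m + poly q m) + 4) \<le> poly q m * (poly p' (m + poly q m) + 4)"
          using b by (rule mult_right_mono) simp
        then show ?thesis using b by (simp add: poly_pcompose algebra_simps)
      qed
      then show "runs x ?c (\<sigma>, 0, y) (\<sigma>(d := \<sigma> d + (\<Sum>i<?F. ?G i)), 0, y) (poly ?p m)"
        using runs_mono[OF runs_Seq[OF 1 runs_Seq[OF 2[unfolded S0] 3]]] by simp
    qed
    then show "\<exists>c. adds (\<lambda>x e. \<Sum>i<f x e. g x (case_nat i e)) \<rho> k d ?p c" by blast
  qed
qed

lemma barith_realizable: "barith f \<Longrightarrow> realizable f"
proof (induction rule: barith.induct)
  case one show ?case by (rule realizable_one)
next
  case len show ?case by (rule realizable_len)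
next
  case bit then show ?case by (intro realizable_bit)
next
  case var show ?case by (rule realizable_var)
next
  case weaken then show ?case by (intro realizable_weaken)
next
  case add then show ?case by (intro realizable_add)
next
  case diff then show ?case by (intro realizable_diff)
next
  case sum then show ?case by (intro realizable_sum)
qed

text \<open>Every output bit is recomputed from its position. The environments are constant:
  \<open>f\<close> finds all its variables in register \<open>0\<close>, which stays zero, and
  \<open>g\<close> finds them in register \<open>1\<close>, the position.\<close>

lemma poly_time_barith:
  assumes "barith f" "barith g"
  shows "poly_time (\<lambda>x. map (\<lambda>i. g x (\<lambda>_. i) \<noteq> 0) [0..<f x (\<lambda>_. 0)])"
proof -
  obtain q p where q: "bounded_by f q"
    and p: "\<And>\<rho> k d. \<forall>i. \<rho> i < k \<and> \<rho> i \<noteq> d \<Longrightarrow> d < k \<Longrightarrow> \<exists>c. adds f \<rho> k d p c"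
    using barith_realizable[OF assms(1)] unfolding realizable_def by blast
  obtain q' p' where q': "bounded_by g q'"
    and p': "\<And>\<rho> k d. \<forall>i. \<rho> i < k \<and> \<rho> i \<noteq> d \<Longrightarrow> d < k \<Longrightarrow> \<exists>c. adds g \<rho> k d p' c"
    using barith_realizable[OF assms(2)] unfolding realizable_def by blast
  obtain c where c: "adds f (\<lambda>_. 0) 5 2 p c" using p[of "\<lambda>_. 0" 5 2] by auto
  obtain c' where c': "adds g (\<lambda>_. 1) 5 3 p' c'" using p'[of "\<lambda>_. 1" 5 3] by auto
  \<comment> \<open>If-then-else made of loops: register \<open>4\<close> is \<open>1\<close> at
    first; a nonzero value in register \<open>3\<close> makes \<open>?T\<close> emit
    \<open>True\<close> and clear the flag, otherwise \<open>?E\<close> emits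
    \<open>False\<close>.\<close>
  let ?T = "While 3 (Seq (While 3 (block [Dec 3])) (block [Emit True, Dec 4]))"
  let ?E = "While 4 (block [Emit False, Dec 4])"
  let ?b = "Seq (block [Dec 2, Inc 4]) (Seq c' (Seq ?T (Seq ?E (Prim (Inc 1)))))"
  let ?c = "Seq c (While 2 ?b)"
  let ?X = "[:0, 1:] + q"
  let ?B = "(p' \<circ>\<^sub>p ?X) + smult 3 (q' \<circ>\<^sub>p ?X) + 18"
  let ?p = "p + q * (?B + 2) + 1"
  show ?thesis
  proof (rule poly_time_exec)
    fix x :: "bool list"
    let ?m = "length x"
    let ?F = "f x (\<lambda>_. 0)" and ?G = "\<lambda>i. g x (\<lambda>_. i)"
    have b: "?F \<le> poly q ?m" using bounded_byD[OF q] by auto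
    have 1: "runs x c (\<lambda>_. 0, 0, []) ((\<lambda>_. 0)(2 := ?F), 0, []) (poly p ?m)"
      by (rule addsD[OF c]) auto
    define S where "S = (\<lambda>i. ((\<lambda>_ :: nat. 0 :: nat)(1 := i, 2 := ?F - i), 0 :: int, map (\<lambda>i. ?G i \<noteq> 0) [0..<i]))"
    have body: "runs x ?b (S i) (S (Suc i)) (poly ?B ?m)" if i: "i < ?F" for i
    proof -
      let ?y = "map (\<lambda>i. ?G i \<noteq> 0) [0..<i]"
      let ?\<sigma> = "(\<lambda>_ :: nat. 0 :: nat)(1 := i, 2 := ?F - Suc i, 4 := 1)"
      have im: "i \<le> ?m + poly q ?m" using b i by simp
      have bG: "?G i \<le> poly q' (?m + poly q ?m)"
        by (rule bounded_byD[OF q']) (use im in auto)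
      have 1: "runs x (block [Dec 2, Inc 4]) (S i) (?\<sigma>, 0, ?y) (Suc (Suc 0))"
        using runs_block[of "[Dec 2, Inc 4]" x "S i"] by (simp add: S_def)
      have 2: "runs x c' (?\<sigma>, 0, ?y) (?\<sigma>(3 := ?G i), 0, ?y) (poly p' (?m + poly q ?m))"
        by (rule addsD[OF c']) (use im in auto)
      have T: "runs x ?T (?\<sigma>(3 := ?G i), 0, ?y)
        (?\<sigma>(4 := of_bool (?G i = 0)), 0, ?y @ (if ?G i = 0 then [] else [True])) (3 * ?G i + 10)"
      proof (cases "?G i = 0")
        case True
        have "runs x ?T (?\<sigma>(3 := ?G i), 0, ?y) (?\<sigma>(3 := ?G i), 0, ?y) 1"
          using True by (auto simp: runs_def intro!: exI[of _ 1] exec.While0)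
        then show ?thesis using True by (auto simp: fun_upd_idem elim: runs_mono)
      next
        case False
        define s where "s = (\<lambda>k :: nat. if k = 0 then (?\<sigma>(3 := ?G i), 0 :: int, ?y)
          else (?\<sigma>(4 := 0), 0, ?y @ [True]))"
        have a: "runs x (While 3 (block [Dec 3])) (?\<sigma>(3 := ?G i), 0, ?y) (?\<sigma>, 0, ?y)
            (?G i * (length [Dec 3] + 2) + 1)"
          by (rule runs_While_block[where S = "\<lambda>k. (?\<sigma>(3 := ?G i - k), 0, ?y)"])
            (auto simp: fun_eq_iff)
        have "runs x (block [Emit True, Dec 4]) (?\<sigma>, 0, ?y) (?\<sigma>(4 := 0), 0, ?y @ [True]) (Suc (Suc 0))"
          using runs_block[of "[Emit True, Dec 4]" x "(?\<sigma>, 0, ?y)"] by simp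
        note ab = runs_Seq[OF a this]
        have "runs x ?T (s 0) (s 1) (1 * (?G i * (length [Dec 3] + 2) + 1 + Suc (Suc 0) + 2) + 1)"
          by (rule runs_While[where S = s]) (use ab False in \<open>auto simp: s_def\<close>)
        then show ?thesis using False by (auto simp: s_def elim: runs_mono)
      qed
      have E: "runs x ?E (?\<sigma>(4 := of_bool (?G i = 0)), 0, ?y @ (if ?G i = 0 then [] else [True]))
        (?\<sigma>(4 := 0), 0, ?y @ [?G i \<noteq> 0]) (of_bool (?G i = 0) * (length [Emit False, Dec 4] + 2) + 1)"
        by (rule runs_While_block[where S = "\<lambda>k. (?\<sigma>(4 := of_bool (?G i = 0) - k), 0,
              ?y @ (if ?G i = 0 then (if k = 0 then [] else [False]) else [True]))"])
          (auto simp: fun_eq_iff of_bool_def split: if_splits)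
      have I: "runs x (Prim (Inc 1)) (?\<sigma>(4 := 0), 0, ?y @ [?G i \<noteq> 0]) (S (Suc i)) 1"
        using runs_Prim[of x "Inc 1" "(?\<sigma>(4 := 0), 0, ?y @ [?G i \<noteq> 0])"]
        by (simp add: S_def fun_upd_twist fun_upd_idem)
      show ?thesis
        by (rule runs_mono[OF runs_Seq[OF 1 runs_Seq[OF 2 runs_Seq[OF T runs_Seq[OF E I]]]]])
          (use bG in \<open>simp add: poly_pcompose of_bool_def\<close>)
    qed
    have "runs x (While 2 ?b) (S 0) (S ?F) (?F * (poly ?B ?m + 2) + 1)"
      by (rule runs_While) (use body in \<open>auto simp: S_def\<close>)
    moreover have "S 0 = ((\<lambda>_. 0)(2 := ?F), 0, [])" by (auto simp: S_def fun_eq_iff)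
    ultimately have "runs x ?c (\<lambda>_. 0, 0, []) (S ?F) (poly p ?m + (?F * (poly ?B ?m + 2) + 1))"
      using runs_Seq[OF 1] by metis
    then have "runs x ?c (\<lambda>_. 0, 0, []) (S ?F) (poly ?p ?m)"
      by (rule runs_mono) (use b in \<open>simp add: mult_right_mono del: pcompose_pCons\<close>)
    then show "\<exists>\<sigma> h t. t \<le> poly ?p ?m \<and> exec x ?c (\<lambda>_. 0, 0, []) (\<sigma>, h, map (\<lambda>i. ?G i \<noteq> 0) [0..<?F]) t"
      unfolding runs_def S_def by blast
  qed
qed

section \<open>Closure properties of bounded arithmetic\<close>

text \<open>Under the binder of \<open>sum\<close>, variable \<open>0\<close> is kept and the terms
  substituted for the other variables are shifted past the new index.\<close>

lemma barith_subst:
  assumes "barith F" "\<And>i. barith (s i)"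
  shows "barith (\<lambda>x e. F x (\<lambda>i. s i x e))"
  using assms
proof (induction arbitrary: s rule: barith.induct)
  case (weaken f)
  show ?case using weaken.IH[of "\<lambda>i. s (Suc i)"] weaken.prems by simp
next
  case (sum f g)
  define s' where "s' = case_nat (\<lambda>x e. e 0) (\<lambda>i x e. s i x (\<lambda>j. e (Suc j)))"
  have "barith (s' i)" for i
    using sum.prems barith.var barith.weaken[OF sum.prems] by (cases i) (simp_all add: s'_def)
  then have "barith (\<lambda>x e. g x (\<lambda>i. s' i x e))" by (rule sum.IH(2))
  from barith.sum[OF sum.IH(1)[OF sum.prems] this]
  have "barith (\<lambda>x e. \<Sum>i<f x (\<lambda>i. s i x e). g x (\<lambda>j. s' j x (case_nat i e)))" .
  moreover have "(\<lambda>j. s' j x (case_nat i e)) = case_nat i (\<lambda>j. s j x e)" for x i e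
    by (auto simp: s'_def fun_eq_iff split: nat.split)
  ultimately show ?case by simp
next
  case one show ?case by (rule barith.one)
next
  case len show ?case by (rule barith.len)
next
  case (bit f) show ?case by (rule barith.bit[OF bit.IH[OF bit.prems]])
next
  case var show ?case by (rule var)
next
  case (add f g)
  show ?case by (rule barith.add[OF add.IH(1)[OF add.prems] add.IH(2)[OF add.prems]])
next
  case (diff f g)
  show ?case by (rule barith.diff[OF diff.IH(1)[OF diff.prems] diff.IH(2)[OF diff.prems]])
qed

lemma barith_comp1:
  assumes "barith (\<lambda>x e. F x (e 0))" "barith f"
  shows "barith (\<lambda>x e. F x (f x e))"
  using barith_subst[OF assms(1), of "\<lambda>_. f"] assms by simp

lemma barith_comp2:
  assumes "barith (\<lambda>x e. F x (e 0) (e (Suc 0)))" "barith f" "barith g"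
  shows "barith (\<lambda>x e. F x (f x e) (g x e))"
  using barith_subst[OF assms(1), of "\<lambda>i. if i = 0 then f else g"] assms by simp

section \<open>Predicates, bounded quantifiers, division and finite tables\<close>

definition barithp :: "(bool list \<Rightarrow> (nat \<Rightarrow> nat) \<Rightarrow> bool) \<Rightarrow> bool" where
  "barithp P \<longleftrightarrow> barith (\<lambda>x e. of_bool (P x e))"

lemma barithp_comp1:
  "barithp (\<lambda>x e. P x (e 0)) \<Longrightarrow> barith f \<Longrightarrow> barithp (\<lambda>x e. P x (f x e))"
  unfolding barithp_def by (rule barith_comp1[of "\<lambda>x n. of_bool (P x n)"])

lemma barithp_comp2:
  "barithp (\<lambda>x e. P x (e 0) (e (Suc 0))) \<Longrightarrow> barith f \<Longrightarrow> barith g \<Longrightarrow>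
   barithp (\<lambda>x e. P x (f x e) (g x e))"
  unfolding barithp_def by (rule barith_comp2[of "\<lambda>x n m. of_bool (P x n m)"])

lemma barith_var: "barith (\<lambda>x e. e n)"
proof (induction n)
  case 0 show ?case by (rule barith.var)
next
  case (Suc n) show ?case using barith.weaken[OF Suc] by simp
qed

lemma barith_const: "barith (\<lambda>x e. c)"
proof (induction c)
  case 0
  then show ?case using barith.diff[OF barith.one barith.one] by simp
next
  case (Suc c)
  then show ?case using barith.add[OF barith.one Suc] by simp
qed

lemma barith_Suc: "barith f \<Longrightarrow> barith (\<lambda>x e. Suc (f x e))"
  using barith.add[OF barith.one, of f] by simp

lemma barith_mult:
  assumes "barith f" "barith g"
  shows "barith (\<lambda>x e. f x e * g x e)"
  using barith.sum[OF assms(1) barith.weaken[OF assms(2)]] by simp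

lemma barith_power: "barith f \<Longrightarrow> barith (\<lambda>x e. f x e ^ c)"
  by (induction c) (auto intro: barith_const barith_mult)

lemma barith_poly: "barith f \<Longrightarrow> barith (\<lambda>x e. poly p (f x e))"
  by (induction p) (auto intro: barith_const barith_mult barith.add)

lemma barith_cong:
  assumes "barith f" "\<And>x e. f x e = g x e"
  shows "barith g"
proof -
  have "f = g" using assms(2) by (intro ext)
  then show ?thesis using assms(1) by simp
qed

text \<open>With truncated subtraction, \<open>1 - (1 - n)\<close> is \<open>1\<close> for positive
  \<open>n\<close> and \<open>0\<close> otherwise; it is applied to the difference of the two
  sides.\<close>

lemma barithp_less:
  assumes "barith f" "barith g"
  shows "barithp (\<lambda>x e. f x e < g x e)"
  unfolding barithp_def
  by (rule barith_cong[OF barith.diff[OF barith.one barith.diff[OF barith.one barith.diff[OF assms(2,1)]]]])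
    (simp add: of_bool_def)

lemma barithp_not:
  assumes "barithp P"
  shows "barithp (\<lambda>x e. \<not> P x e)"
  unfolding barithp_def
  by (rule barith_cong[OF barith.diff[OF barith.one assms[unfolded barithp_def]]]) (simp add: of_bool_def)

lemma barithp_conj:
  assumes "barithp P" "barithp Q"
  shows "barithp (\<lambda>x e. P x e \<and> Q x e)"
  using barith_mult[OF assms[unfolded barithp_def]] by (simp only: barithp_def of_bool_conj)

lemma barithp_disj: "barithp P \<Longrightarrow> barithp Q \<Longrightarrow> barithp (\<lambda>x e. P x e \<or> Q x e)"
  using barithp_not[OF barithp_conj[OF barithp_not barithp_not]] by simp

lemma barithp_imp: "barithp P \<Longrightarrow> barithp Q \<Longrightarrow> barithp (\<lambda>x e. P x e \<longrightarrow> Q x e)"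
  using barithp_disj[OF barithp_not, of P Q] by simp

lemma barithp_le: "barith f \<Longrightarrow> barith g \<Longrightarrow> barithp (\<lambda>x e. f x e \<le> g x e)"
  using barithp_not[OF barithp_less, of g f] by (simp add: not_less)

lemma barithp_eq: "barith f \<Longrightarrow> barith g \<Longrightarrow> barithp (\<lambda>x e. f x e = g x e)"
  using barithp_conj[OF barithp_le barithp_le, of f g g f] by (simp only: order_eq_iff)

lemma barithp_iff: "barithp P \<Longrightarrow> barithp Q \<Longrightarrow> barithp (\<lambda>x e. P x e \<longleftrightarrow> Q x e)"
  using barithp_conj[OF barithp_imp barithp_imp, of P Q Q P] by (simp only: iff_conv_conj_imp)

lemma barithp_const: "barithp (\<lambda>x e. c)"
  unfolding barithp_def by (rule barith_const)

lemma barithp_ex: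
  assumes "barith f" "barithp (\<lambda>x e. P x (\<lambda>i. e (Suc i)) (e 0))"
  shows "barithp (\<lambda>x e. \<exists>i<f x e. P x e i)"
proof -
  have "barith (\<lambda>x e. \<Sum>i<f x e. of_bool (P x e i))"
    using barith.sum[OF assms[unfolded barithp_def]] by simp
  then have "barithp (\<lambda>x e. 0 < (\<Sum>i<f x e. of_bool (P x e i) :: nat))"
    by (intro barithp_less barith_const)
  moreover have "0 < (\<Sum>i<n. of_bool (Q i) :: nat) \<longleftrightarrow> (\<exists>i<n. Q i)" for n :: nat and Q
    by (induction n) (auto simp: less_Suc_eq)
  ultimately show ?thesis by simp
qed

lemma barithp_all:
  assumes "barith f" "barithp (\<lambda>x e. P x (\<lambda>i. e (Suc i)) (e 0))"
  shows "barithp (\<lambda>x e. \<forall>i<f x e. P x e i)"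
  using barithp_not[OF barithp_ex[OF assms(1) barithp_not[OF assms(2)]]] by simp

lemma barith_of_bool: "barithp P \<Longrightarrow> barith (\<lambda>x e. of_bool (P x e))"
  by (simp add: barithp_def)

lemma barith_if:
  assumes "barithp P" "barith f" "barith g"
  shows "barith (\<lambda>x e. if P x e then f x e else g x e)"
proof -
  have "barith (\<lambda>x e. of_bool (P x e) * f x e + of_bool (\<not> P x e) * g x e)"
    using assms by (intro barith.add barith_mult barith_of_bool barithp_not)
  moreover have "(\<lambda>x e. of_bool (P x e) * f x e + of_bool (\<not> P x e) * g x e)
      = (\<lambda>x e. if P x e then f x e else g x e)"
    by (auto simp: fun_eq_iff)
  ultimately show ?thesis by simp
qed

text \<open>The quotient counts the positive multiples of \<open>b\<close> that do not exceed
  \<open>a\<close>.\<close>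

lemma div_eq_sum: "0 < b \<Longrightarrow> (\<Sum>i<a. of_bool (Suc i * b \<le> a)) = a div (b :: nat)"
proof -
  assume b: "0 < b"
  have "{i. i < a \<and> Suc i * b \<le> a} = {..<a div b}"
  proof -
    have "Suc i * b \<le> a \<longleftrightarrow> i < a div b" for i
      using less_eq_div_iff_mult_less_eq[OF b, of "Suc i" a] by auto
    moreover have "i < a" if "i < a div b" for i
      using that div_le_dividend[of a b] by linarith
    ultimately show ?thesis by blast
  qed
  moreover have "(\<Sum>i<a. of_bool (Suc i * b \<le> a)) = card {i. i < a \<and> Suc i * b \<le> a}"
    by (simp add: lessThan_def Collect_conj_eq[symmetric] flip: sum.inter_filter)
  ultimately show ?thesis by simp
qed

lemma barith_div:
  assumes "barith f" "barith g"
  shows "barith (\<lambda>x e. f x e div g x e)"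
proof -
  have "barithp (\<lambda>x e. Suc (e 0) * g x (\<lambda>i. e (Suc i)) \<le> f x (\<lambda>i. e (Suc i)))"
    using assms by (intro barithp_le barith_mult barith_Suc barith_var barith.weaken)
  from barith.sum[OF assms(1) this[unfolded barithp_def]]
  have "barith (\<lambda>x e. \<Sum>i<f x e. of_bool (Suc i * g x e \<le> f x e))" by simp
  \<comment> \<open>For divisor \<open>0\<close> the sum would be \<open>f x e\<close>, whereas
    division by \<open>0\<close> yields \<open>0\<close>.\<close>
  then have "barith (\<lambda>x e. if g x e = 0 then 0 else \<Sum>i<f x e. of_bool (Suc i * g x e \<le> f x e))"
    using assms by (intro barith_if barithp_eq barith_const)
  moreover have "(\<lambda>x e. if g x e = 0 then 0 else \<Sum>i<f x e. of_bool (Suc i * g x e \<le> f x e))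
      = (\<lambda>x e. f x e div g x e)"
    by (auto simp only: fun_eq_iff div_eq_sum div_by_0 split: if_splits)
  ultimately show ?thesis by simp
qed

lemma barith_mod: "barith f \<Longrightarrow> barith g \<Longrightarrow> barith (\<lambda>x e. f x e mod g x e)"
  using barith.diff[OF _ barith_mult[OF barith_div], of f f g g] by (simp add: modulo_nat_def)

lemma barith_sum_const:
  assumes "\<And>c. barith (F c)"
  shows "barith (\<lambda>x e. \<Sum>c<(n :: nat). F c x e)"
  by (induction n) (auto intro: barith_const barith.add assms)

text \<open>A table with finite support is a fixed combination of indicator functions. This is how
  the transition function of an arbitrary machine enters the arithmetic.\<close>

lemma barith_table:
  assumes "barith f" "barith g" and zero: "\<And>a b. \<not> (a < m \<and> b < n) \<Longrightarrow> tab a b = 0"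
  shows "barith (\<lambda>x e. tab (f x e) (g x e))"
proof -
  have "barith (\<lambda>x e. \<Sum>a<m. \<Sum>b<n. of_bool (f x e = a \<and> g x e = b) * tab a b)"
    using assms(1,2)
    by (intro barith_sum_const barith_mult barith_of_bool barithp_conj barithp_eq barith_const)
  moreover have "(\<Sum>a<m. \<Sum>b<n. of_bool (i = a \<and> j = b) * tab a b) = tab i j" for i j
  proof -
    have "(\<Sum>a<m. \<Sum>b<n. of_bool (i = a \<and> j = b) * tab a b)
        = (\<Sum>a<m. if a = i then \<Sum>b<n. if b = j then tab i j else 0 else 0)"
    proof (rule sum.cong[OF refl])
      fix a
      show "(\<Sum>b<n. of_bool (i = a \<and> j = b) * tab a b)
          = (if a = i then \<Sum>b<n. if b = j then tab i j else 0 else 0)"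
        by (cases "a = i") (auto intro!: sum.cong)
    qed
    also have "\<dots> = tab i j" using zero[of i j] by auto
    finally show ?thesis .
  qed
  ultimately show ?thesis by simp
qed

definition bit_at :: "bool list \<Rightarrow> nat \<Rightarrow> bool" where
  "bit_at x i \<longleftrightarrow> i < length x \<and> x ! i"

lemma barithp_bit_at: "barith f \<Longrightarrow> barithp (\<lambda>x e. bit_at x (f x e))"
  unfolding barithp_def bit_at_def by (rule barith.bit)

lemmas barith_intros =
  barith_const barith_var barith.len barith.add barith.diff barith_mult barith_Suc barith_div barith_mod
  barith_power barith_poly barith_if barith_of_bool
  barithp_const barithp_less barithp_le barithp_eq barithp_not barithp_conj barithp_disj barithp_imp barithp_iff
  barithp_ex barithp_all barithp_bit_at

lemma class_P_barith:
  assumes "barithp (\<lambda>x e. P x)"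
  shows "{x. P x} \<in> class_P"
proof -
  have "poly_time (\<lambda>x. map (\<lambda>i. of_bool (P x) \<noteq> (0 :: nat)) [0..<1])"
    using poly_time_barith[OF barith.one assms[unfolded barithp_def]] .
  then show ?thesis by (simp add: class_P_def)
qed

section \<open>Instances of SHED as words\<close>

definition graph_of :: "nat \<Rightarrow> (nat \<Rightarrow> nat \<Rightarrow> bool) \<Rightarrow> nat pair_pre_digraph" where
  "graph_of N A = \<lparr>pverts = {..<N}, parcs = {(i, j). i < N \<and> j < N \<and> A i j}\<rparr>"

definition simple_adj :: "nat \<Rightarrow> (nat \<Rightarrow> nat \<Rightarrow> bool) \<Rightarrow> bool" where
  "simple_adj N A \<longleftrightarrow> (\<forall>i<N. \<not> A i i) \<and> (\<forall>i<N. \<forall>j<N. A i j \<longrightarrow> A j i)"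

definition no_triangle :: "nat \<Rightarrow> (nat \<Rightarrow> nat \<Rightarrow> bool) \<Rightarrow> bool" where
  "no_triangle N A \<longleftrightarrow> (\<forall>a<N. \<forall>b<N. \<forall>c<N. \<not> (A a b \<and> A b c \<and> A c a))"

text \<open>\<open>W\<close> is the characteristic function of an independent set showing that \<open>v\<close> is not shedding.\<close>

definition refutes :: "nat \<Rightarrow> (nat \<Rightarrow> nat \<Rightarrow> bool) \<Rightarrow> nat \<Rightarrow> (nat \<Rightarrow> bool) \<Rightarrow> bool" where
  "refutes N A v W \<longleftrightarrow> (\<forall>j<N. W j \<longrightarrow> j \<noteq> v \<and> \<not> A v j) \<and>
     (\<forall>i<N. \<forall>j<N. W i \<and> W j \<longrightarrow> \<not> A i j) \<and>
     (\<forall>u<N. A v u \<longrightarrow> (\<exists>s<N. W s \<and> A u s))"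

lemma simple_adjD:
  assumes "simple_adj N A"
  shows "i < N \<Longrightarrow> \<not> A i i" "i < N \<Longrightarrow> j < N \<Longrightarrow> A i j \<Longrightarrow> A j i"
  using assms unfolding simple_adj_def by blast+

lemma simple_adj_cong:
  "(\<And>i j. i < N \<Longrightarrow> j < N \<Longrightarrow> A i j = B i j) \<Longrightarrow> simple_adj N A = simple_adj N B"
  by (simp add: simple_adj_def)

lemma no_triangle_cong:
  "(\<And>i j. i < N \<Longrightarrow> j < N \<Longrightarrow> A i j = B i j) \<Longrightarrow> no_triangle N A = no_triangle N B"
  by (simp add: no_triangle_def)

lemma refutes_cong:
  assumes "v < N" "\<And>i j. i < N \<Longrightarrow> j < N \<Longrightarrow> A i j = B i j" "\<And>i. i < N \<Longrightarrow> W i = W' i"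
  shows "refutes N A v W = refutes N B v W'"
  using assms by (simp add: refutes_def cong: conj_cong)

lemma graph_of_sel [simp]:
  "pverts (graph_of N A) = {..<N}"
  "(i, j) \<in> parcs (graph_of N A) \<longleftrightarrow> i < N \<and> j < N \<and> A i j"
  by (auto simp: graph_of_def)

lemma graph_of_cong: "(\<And>i j. i < N \<Longrightarrow> j < N \<Longrightarrow> A i j = B i j) \<Longrightarrow> graph_of N A = graph_of N B"
  by (auto simp: graph_of_def)

lemma pair_graph_graph_of: "pair_graph (graph_of N A) \<longleftrightarrow> simple_adj N A"
proof
  assume "pair_graph (graph_of N A)"
  then interpret pair_graph "graph_of N A" .
  show "simple_adj N A"
    unfolding simple_adj_def
  proof (intro conjI allI impI)
    fix i assume "i < N"
    then show "\<not> A i i" using pair_no_loops[of "(i, i)"] by auto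
  next
    fix i j assume "i < N" "j < N" "A i j"
    then show "A j i" using pair_sym_arcs symD[of "parcs (graph_of N A)" i j] by (auto simp: symmetric_def)
  qed
next
  assume A: "simple_adj N A"
  have "finite (parcs (graph_of N A))"
    by (rule finite_subset[of _ "{..<N} \<times> {..<N}"]) (auto simp: graph_of_def)
  moreover have "symmetric (graph_of N A)"
    using simple_adjD(2)[OF A] by (auto simp: symmetric_def intro!: symI)
  moreover have "fst e \<noteq> snd e" if "e \<in> parcs (graph_of N A)" for e
    using that simple_adjD(1)[OF A] by (cases e) auto
  ultimately show "pair_graph (graph_of N A)"
    by unfold_locales auto
qed

lemma triangle_free_graph_of:
  assumes "simple_adj N A"
  shows "triangle_free (graph_of N A) \<longleftrightarrow> no_triangle N A"
proof -
  have len3: "length p = 3 \<longleftrightarrow> (\<exists>d e f. p = [d, e, f])" for p :: "(nat \<times> nat) list"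
    by (auto simp: numeral_3_eq_3 length_Suc_conv)
  have "(\<exists>p. pre_digraph.cycle (with_proj (graph_of N A)) p \<and> length p = 3) \<longleftrightarrow>
    (\<exists>a<N. \<exists>b<N. \<exists>c<N. A a b \<and> A b c \<and> A c a \<and> distinct [a, b, c])" (is "?L \<longleftrightarrow> ?R")
  proof
    assume ?L
    then obtain d e f where "pre_digraph.cycle (with_proj (graph_of N A)) [d, e, f]"
      unfolding len3 by blast
    then obtain u where "set [d, e, f] \<subseteq> parcs (graph_of N A)" "pcas u [d, e, f] u"
        "distinct (tl (pawalk_verts u [d, e, f]))"
      unfolding pre_digraph.cycle_def pre_digraph.awalk_def
        cas_with_proj_eq awalk_verts_with_proj_eq with_proj_simps by blast
    then have "fst d < N \<and> fst e < N \<and> fst f < N \<and> A (fst d) (fst e) \<and> A (fst e) (fst f) \<and>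
        A (fst f) (fst d) \<and> distinct [fst d, fst e, fst f]"
      by (cases d; cases e; cases f) auto
    then show ?R by blast
  next
    assume ?R
    then obtain a b c where "a < N" "b < N" "c < N" "A a b" "A b c" "A c a" "distinct [a, b, c]"
      by blast
    then show ?L
      unfolding pre_digraph.cycle_def pre_digraph.awalk_def cas_with_proj_eq awalk_verts_with_proj_eq
      by (intro exI[of _ "[(a, b), (b, c), (c, a)]"] conjI exI[of _ a]) auto
  qed
  moreover have "distinct [a, b, c]" if "a < N" "b < N" "c < N" "A a b" "A b c" "A c a" for a b c
    using that simple_adjD(1)[OF assms] by auto
  ultimately show ?thesis unfolding triangle_free_def no_triangle_def by blast
qed

text \<open>The domination clause of \<open>refutes\<close> may insist on a neighbour in
  \<open>W\<close>: a vertex adjacent to \<open>v\<close> is never in \<open>W\<close> itself, since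
  \<open>W\<close> avoids the closed neighbourhood of \<open>v\<close>.\<close>

lemma shedding_graph_of:
  assumes A: "simple_adj N A" and v: "v < N"
  shows "shedding (graph_of N A) v \<longleftrightarrow> \<not> (\<exists>W. refutes N A v W)"
proof
  assume shed: "shedding (graph_of N A) v"
  show "\<not> (\<exists>W. refutes N A v W)"
  proof
    assume "\<exists>W. refutes N A v W"
    then obtain W where W: "refutes N A v W" ..
    let ?S = "{s. s < N \<and> W s}"
    have "?S \<subseteq> pverts (graph_of N A) - closed_nbhd (graph_of N A) v" "indep_set (graph_of N A) ?S"
      using W by (auto simp: refutes_def closed_nbhd_def nbhd_def indep_set_def)
    then obtain u where u: "u < N" "A v u" and ind: "indep_set (graph_of N A) (insert u ?S)"
      using shed unfolding shedding_def by (auto simp: nbhd_def)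
    obtain s where s: "s < N" "W s" "A u s" using W u by (auto simp: refutes_def)
    then have "s \<noteq> u" using simple_adjD(1)[OF A] by blast
    then show False using ind s u by (auto simp: indep_set_def)
  qed
next
  assume ref: "\<not> (\<exists>W. refutes N A v W)"
  show "shedding (graph_of N A) v"
    unfolding shedding_def
  proof (intro conjI allI impI, goal_cases)
    case 1 then show ?case using v by simp
  next
    case (2 S)
    have S: "S \<subseteq> {..<N}" "v \<notin> S" "\<And>s. s \<in> S \<Longrightarrow> \<not> A v s"
      using 2 v by (auto simp: closed_nbhd_def nbhd_def)
    have ind: "\<not> A s t" if "s \<in> S" "t \<in> S" for s t
    proof -
      have "s < N" "t < N" using S(1) that by auto
      then show ?thesis
        using 2 that simple_adjD(1)[OF A, of s] by (cases "s = t") (auto simp: indep_set_def)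
    qed
    have "\<not> refutes N A v (\<lambda>s. s \<in> S)" using ref by blast
    then have "\<not> (\<forall>u<N. A v u \<longrightarrow> (\<exists>s<N. s \<in> S \<and> A u s))"
      using S ind by (auto simp: refutes_def)
    then obtain u where "u < N" "A v u" "\<And>s. s < N \<Longrightarrow> s \<in> S \<Longrightarrow> \<not> A u s"
      by auto
    then have u: "u < N" "A v u" "\<And>s. s \<in> S \<Longrightarrow> \<not> A u s"
      using S(1) by auto
    have "\<not> A s u" if "s \<in> S" for s
      using u(1) u(3)[OF that] S(1) that simple_adjD(2)[OF A, of s u] by blast
    then have "indep_set (graph_of N A) (insert u S)"
      using u S ind by (auto simp: indep_set_def)
    then show ?case using u v by (auto simp: nbhd_def)
  qed
qed

section \<open>Instances as words, position by position\<close>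

definition enc :: "nat \<Rightarrow> nat \<Rightarrow> (nat \<Rightarrow> nat \<Rightarrow> bool) \<Rightarrow> bool list" where
  "enc N v A = replicate N True @ [False] @ replicate v True @ [False] @
     concat (map (\<lambda>i. map (\<lambda>j. A i j) [0..<N]) [0..<N])"

lemma concat_rows:
  "concat (map (\<lambda>i. map (\<lambda>j. A i j) [0..<N]) [0..<M]) = map (\<lambda>p. A (p div N) (p mod N)) [0..<M * N]"
proof (induction M)
  case (Suc M)
  have "[0..<Suc M * N] = [0..<M * N] @ map (\<lambda>j. j + M * N) [0..<N]"
    using upt_add_eq_append[of 0 "M * N" N] map_add_upt[of "M * N" N] by (simp add: add.commute)
  moreover have "map (\<lambda>p. A (p div N) (p mod N)) (map (\<lambda>j. j + M * N) [0..<N]) = map (A M) [0..<N]"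
    by auto
  ultimately show ?case using Suc by simp
qed simp

definition word_bit :: "nat \<Rightarrow> nat \<Rightarrow> (nat \<Rightarrow> nat \<Rightarrow> bool) \<Rightarrow> nat \<Rightarrow> bool" where
  "word_bit N v A p \<longleftrightarrow> p < N \<or> N < p \<and> p < N + 1 + v \<or>
     N + v + 2 \<le> p \<and> A ((p - (N + v + 2)) div N) ((p - (N + v + 2)) mod N)"

lemma position_cases:
  fixes p N v M :: nat
  assumes "p < N + v + 2 + M"
  obtains "p < N" | "p = N" | i where "p = N + 1 + i" "i < v" | "p = N + 1 + v"
    | i where "p = N + v + 2 + i" "i < M"
proof -
  consider "p < N" | "p = N" | "N < p" "p < N + 1 + v" | "p = N + 1 + v" | "N + v + 2 \<le> p"
    by linarith
  then show ?thesis
  proof cases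
    case 3
    then show ?thesis using that(3)[of "p - (N + 1)"] by simp
  next
    case 5
    then show ?thesis using that(5)[of "p - (N + v + 2)"] assms by simp
  qed (use that in auto)
qed

text \<open>Brings the encoding into the shape that \<open>poly_time_barith\<close> produces: a
  length together with a predicate of the position.\<close>

lemma enc_conv_map: "enc N v A = map (word_bit N v A) [0..<N + v + 2 + N * N]"
proof (rule nth_equalityI)
  show "length (enc N v A) = length (map (word_bit N v A) [0..<N + v + 2 + N * N])"
    by (simp add: enc_def concat_rows)
  fix p assume "p < length (enc N v A)"
  then have p: "p < N + v + 2 + N * N" by (simp add: enc_def concat_rows)
  then have "map (word_bit N v A) [0..<N + v + 2 + N * N] ! p = word_bit N v A p"
    by (simp del: upt_Suc)
  also have "\<dots> = enc N v A ! p"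
    using p by (cases rule: position_cases)
      (auto simp: enc_def concat_rows word_bit_def nth_append nth_Cons')
  finally show "enc N v A ! p = map (word_bit N v A) [0..<N + v + 2 + N * N] ! p" ..
qed

lemma encode_instance_graph_of: "encode_instance (graph_of N A) v = enc N v A"
proof -
  have rows: "map (\<lambda>i. map (\<lambda>j. (i, j) \<in> parcs (graph_of N A)) [0..<N]) [0..<N]
      = map (\<lambda>i. map (\<lambda>j. A i j) [0..<N]) [0..<N]"
    by (intro map_cong refl) auto
  show ?thesis
    by (simp only: encode_instance_def enc_def Let_def graph_of_sel(1) card_lessThan rows)
qed

section \<open>Unique decoding of words\<close>

definition well_formed :: "nat \<Rightarrow> (nat \<Rightarrow> bool) \<Rightarrow> nat \<Rightarrow> nat \<Rightarrow> bool" where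
  "well_formed n X N v \<longleftrightarrow> n = N + v + 2 + N * N \<and> (\<forall>i<N. X i) \<and> \<not> X N \<and>
     (\<forall>i<v. X (N + 1 + i)) \<and> \<not> X (N + 1 + v)"

definition matrix :: "(nat \<Rightarrow> bool) \<Rightarrow> nat \<Rightarrow> nat \<Rightarrow> nat \<Rightarrow> nat \<Rightarrow> bool" where
  "matrix X N v i j \<longleftrightarrow> X (N + v + 2 + (i * N + j))"

lemma matrix_index: "i < N \<Longrightarrow> j < N \<Longrightarrow> i * N + j < N * (N :: nat)"
  using mult_le_mono1[of "Suc i" N N] by simp

lemma well_formed_cong:
  assumes "\<And>i. i < n \<Longrightarrow> X i = Y i"
  shows "well_formed n X N v = well_formed n Y N v"
proof (cases "n = N + v + 2 + N * N")
  case True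
  have "X i = Y i" if "i \<le> N + v + 1" for i using that assms True by simp
  then show ?thesis unfolding well_formed_def by simp
qed (simp add: well_formed_def)

text \<open>\<open>N\<close> is the position of the first \<open>False\<close> and \<open>v\<close>
  the length of the following run of \<open>True\<close>; of two different candidates, the smaller
  needs \<open>False\<close> where the larger needs \<open>True\<close>.\<close>

lemma well_formed_unique:
  assumes "well_formed n X N v" "well_formed n X N' v'"
  shows "N = N'" "v = v'"
proof -
  show "N = N'"
    using assms by (cases N N' rule: linorder_cases) (auto simp: well_formed_def)
  then show "v = v'"
    using assms by (cases v v' rule: linorder_cases) (auto simp: well_formed_def)
qed

lemma well_formed_enc: "well_formed (length (enc N v A)) ((!) (enc N v A)) N v"
proof -
  have nth: "enc N v A ! p = word_bit N v A p" if "p < N + v + 2 + N * N" for p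
    using that by (simp add: enc_conv_map del: upt_Suc)
  have "length (enc N v A) = N + v + 2 + N * N" by (simp add: enc_conv_map)
  then show ?thesis by (auto simp: well_formed_def nth word_bit_def)
qed

lemma matrix_enc:
  assumes "i < N" "j < N"
  shows "matrix ((!) (enc N v A)) N v i j = A i j"
  using matrix_index[OF assms] assms
  by (simp add: matrix_def enc_conv_map word_bit_def del: upt_Suc)

lemma enc_matrix:
  assumes "well_formed (length x) ((!) x) N v"
  shows "x = enc N v (matrix ((!) x) N v)"
proof (rule nth_equalityI)
  show len: "length x = length (enc N v (matrix ((!) x) N v))"
    using assms by (simp add: well_formed_def enc_conv_map)
  fix p assume "p < length x"
  then have p: "p < N + v + 2 + N * N" using assms by (simp add: well_formed_def)
  have "x ! p = word_bit N v (matrix ((!) x) N v) p"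
    using p assms by (cases rule: position_cases)
      (auto simp: well_formed_def word_bit_def matrix_def)
  then show "x ! p = enc N v (matrix ((!) x) N v) ! p"
    using p by (simp add: enc_conv_map del: upt_Suc)
qed

text \<open>Membership only says that some instance has this code. Unique decoding identifies it
  with the given one, as \<open>graph_of\<close> depends on \<open>A\<close> below \<open>N\<close>
  only.\<close>

lemma SHED_on_enc:
  assumes "simple_adj N A" "v < N"
  shows "enc N v A \<in> SHED_on C \<longleftrightarrow> C (graph_of N A) \<and> shedding (graph_of N A) v"
proof
  assume "enc N v A \<in> SHED_on C"
  then obtain G u where G: "enc N v A = encode_instance G u" "pair_graph G"
      "pverts G = {..<card (pverts G)}" "C G" "shedding G u"
    unfolding SHED_on_def by blast
  define M B where "M = card (pverts G)" and "B = (\<lambda>i j. (i, j) \<in> parcs G)"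
  interpret pair_graph G by fact
  have "pverts G = {..<M}" unfolding M_def by (rule G(3))
  moreover from this have "parcs G = {(i, j). i < M \<and> j < M \<and> B i j}"
    using in_arcsD1 in_arcsD2 unfolding B_def by blast
  ultimately have GB: "G = graph_of M B" unfolding graph_of_def by (cases G) auto
  have eq: "enc N v A = enc M u B" using G(1) by (simp add: GB encode_instance_graph_of)
  have "well_formed (length (enc N v A)) ((!) (enc N v A)) M u"
    unfolding eq by (rule well_formed_enc)
  from well_formed_unique[OF this well_formed_enc] have Mu: "M = N" "u = v" by auto
  have "A i j = B i j" if "i < N" "j < N" for i j
    using matrix_enc[of i N j v A] matrix_enc[of i M j u B] that eq Mu by simp
  then have "graph_of N A = G" unfolding GB Mu by (intro graph_of_cong)
  then show "C (graph_of N A) \<and> shedding (graph_of N A) v" using G(4,5) Mu by simp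
next
  assume "C (graph_of N A) \<and> shedding (graph_of N A) v"
  then show "enc N v A \<in> SHED_on C"
    using assms unfolding SHED_on_def
    by (intro CollectI exI[of _ "graph_of N A"] exI[of _ v])
      (simp add: encode_instance_graph_of pair_graph_graph_of)
qed

lemma SHED_on_iff:
  "x \<in> SHED_on C \<longleftrightarrow> (\<exists>N v. well_formed (length x) ((!) x) N v \<and> v < N \<and>
     simple_adj N (matrix ((!) x) N v) \<and> C (graph_of N (matrix ((!) x) N v)) \<and>
     \<not> (\<exists>W. refutes N (matrix ((!) x) N v) v W))"
proof
  assume x: "x \<in> SHED_on C"
  then obtain G v where G: "x = encode_instance G v" "pair_graph G"
      "pverts G = {..<card (pverts G)}" "v \<in> pverts G"
    unfolding SHED_on_def by blast
  define N A where "N = card (pverts G)" and "A = (\<lambda>i j. (i, j) \<in> parcs G)"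
  interpret pair_graph G by fact
  have "pverts G = {..<N}" unfolding N_def by (rule G(3))
  moreover from this have "parcs G = {(i, j). i < N \<and> j < N \<and> A i j}"
    using in_arcsD1 in_arcsD2 unfolding A_def by blast
  ultimately have GA: "G = graph_of N A" unfolding graph_of_def by (cases G) auto
  have v: "v < N" using G(4) by (simp add: GA)
  have simple: "simple_adj N A" using G(2) by (simp add: GA pair_graph_graph_of)
  have eq: "x = enc N v A" using G(1) by (simp add: GA encode_instance_graph_of)
  define B where "B = matrix ((!) x) N v"
  have AB: "A i j = B i j" if "i < N" "j < N" for i j
    using matrix_enc that by (simp add: B_def eq)
  have gr: "graph_of N A = graph_of N B" by (rule graph_of_cong[OF AB])
  have simpleB: "simple_adj N B" using simple simple_adj_cong[OF AB] by simp
  show "\<exists>N v. well_formed (length x) ((!) x) N v \<and> v < N \<and>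
     simple_adj N (matrix ((!) x) N v) \<and> C (graph_of N (matrix ((!) x) N v)) \<and>
     \<not> (\<exists>W. refutes N (matrix ((!) x) N v) v W)"
    using x SHED_on_enc[OF simple v] well_formed_enc[of N v A] v simpleB
      shedding_graph_of[OF simpleB v]
    unfolding gr by (intro exI[of _ N] exI[of _ v]) (simp add: B_def flip: eq)
next
  assume "\<exists>N v. well_formed (length x) ((!) x) N v \<and> v < N \<and>
     simple_adj N (matrix ((!) x) N v) \<and> C (graph_of N (matrix ((!) x) N v)) \<and>
     \<not> (\<exists>W. refutes N (matrix ((!) x) N v) v W)"
  then obtain N v where *: "well_formed (length x) ((!) x) N v" "v < N"
     "simple_adj N (matrix ((!) x) N v)" "C (graph_of N (matrix ((!) x) N v))"
     "\<not> (\<exists>W. refutes N (matrix ((!) x) N v) v W)" by blast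
  show "x \<in> SHED_on C"
    by (subst enc_matrix[OF *(1)])
      (use * SHED_on_enc[OF *(3,2)] shedding_graph_of[OF *(3,2)] in blast)
qed

section \<open>SHED is in coNP\<close>

text \<open>Pairs of equal bits come from the doubled first component, so the first unequal pair is
  the separator and its index \<open>n\<close> is the length of that component.\<close>

definition separates :: "bool list \<Rightarrow> nat \<Rightarrow> bool" where
  "separates z n \<longleftrightarrow> \<not> (bit_at z (2 * n) \<longleftrightarrow> bit_at z (Suc (2 * n))) \<and>
     (\<forall>m<n. bit_at z (2 * m) \<longleftrightarrow> bit_at z (Suc (2 * m)))"

text \<open>The flag \<open>tf\<close> says whether the instances have to be triangle-free.\<close>

definition refutation :: "bool \<Rightarrow> nat \<Rightarrow> (nat \<Rightarrow> bool) \<Rightarrow> (nat \<Rightarrow> bool) \<Rightarrow> bool" where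
  "refutation tf n X W \<longleftrightarrow> (\<forall>N<Suc n. \<forall>v<Suc n. well_formed n X N v \<and> v < N \<and>
     simple_adj N (matrix X N v) \<and> (tf \<longrightarrow> no_triangle N (matrix X N v)) \<longrightarrow>
     refutes N (matrix X N v) v W)"

text \<open>Instead of parsing, all candidates for \<open>n\<close>, \<open>N\<close> and
  \<open>v\<close> are tried. At most one choice fits, so a universal quantifier does no harm, and
  it lets words that encode no instance pass, as the complement demands.\<close>

definition verifier :: "bool \<Rightarrow> language" where
  "verifier tf = {z. \<forall>n<length z. separates z n \<longrightarrow>
     refutation tf n (\<lambda>i. bit_at z (2 * i)) (\<lambda>j. bit_at z (2 * n + 2 + j))}"

lemma verifier_class_P: "verifier tf \<in> class_P"
  unfolding verifier_def separates_def refutation_def well_formed_def simple_adj_def no_triangle_def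
    matrix_def refutes_def
  by (rule class_P_barith) (intro barith_intros)

lemma length_pair_code [simp]: "length (pair_code x w) = 2 * length x + 2 + length w"
  by (induction x) (auto simp: pair_code_def)

lemma nth_pair_code:
  "i < length x \<Longrightarrow> pair_code x w ! (2 * i) = x ! i"
  "i < length x \<Longrightarrow> pair_code x w ! Suc (2 * i) = x ! i"
  "pair_code x w ! (2 * length x) = False"
  "pair_code x w ! Suc (2 * length x) = True"
  "pair_code x w ! Suc (Suc (2 * length x + j)) = w ! j"
proof -
  have pre: "i < length x \<Longrightarrow> concat (map (\<lambda>b. [b, b]) x) ! (2 * i) = x ! i \<and>
    concat (map (\<lambda>b. [b, b]) x) ! Suc (2 * i) = x ! i" for i
  proof (induction x arbitrary: i)
    case (Cons b x)
    then show ?case by (cases i) auto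
  qed simp
  have len: "length (concat (map (\<lambda>b. [b, b]) x)) = 2 * length x" by (induction x) auto
  show "i < length x \<Longrightarrow> pair_code x w ! (2 * i) = x ! i"
    "i < length x \<Longrightarrow> pair_code x w ! Suc (2 * i) = x ! i"
    using pre[of i] by (auto simp: pair_code_def nth_append len)
  show "pair_code x w ! (2 * length x) = False" "pair_code x w ! Suc (2 * length x) = True"
    "pair_code x w ! Suc (Suc (2 * length x + j)) = w ! j"
    by (auto simp: pair_code_def nth_append len)
qed

lemma separates_pair_code: "separates (pair_code x w) n \<longleftrightarrow> n = length x"
proof
  assume n: "separates (pair_code x w) n"
  show "n = length x"
  proof (rule linorder_cases)
    assume "n < length x"
    then show ?thesis using n by (auto simp: separates_def nth_pair_code bit_at_def)
  next
    assume "n > length x"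
    then have "bit_at (pair_code x w) (2 * length x) \<longleftrightarrow> bit_at (pair_code x w) (Suc (2 * length x))"
      using n unfolding separates_def by blast
    then show ?thesis by (simp add: nth_pair_code bit_at_def)
  qed
qed (auto simp: separates_def nth_pair_code bit_at_def)

lemma pair_code_in_verifier:
  "pair_code x w \<in> verifier tf \<longleftrightarrow> refutation tf (length x) ((!) x) (\<lambda>j. bit_at w j)"
proof -
  let ?z = "pair_code x w" and ?n = "length x"
  let ?X = "\<lambda>i. bit_at ?z (2 * i)"
  have X: "?X i = x ! i" if "i < ?n" for i using that by (simp add: nth_pair_code bit_at_def)
  have W: "(\<lambda>j. bit_at ?z (2 * ?n + 2 + j)) = (\<lambda>j. bit_at w j)"
    by (simp add: nth_pair_code bit_at_def)
  have "?z \<in> verifier tf \<longleftrightarrow> refutation tf ?n ?X (\<lambda>j. bit_at w j)"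
    unfolding verifier_def mem_Collect_eq separates_pair_code W[symmetric] by auto
  also have "\<dots> \<longleftrightarrow> refutation tf ?n ((!) x) (\<lambda>j. bit_at w j)"
  proof -
    have "(well_formed ?n ?X N v \<and> v < N \<and>
       simple_adj N (matrix ?X N v) \<and> (tf \<longrightarrow> no_triangle N (matrix ?X N v)) \<longrightarrow>
       refutes N (matrix ?X N v) v W) \<longleftrightarrow> (well_formed ?n ((!) x) N v \<and> v < N \<and>
       simple_adj N (matrix ((!) x) N v) \<and> (tf \<longrightarrow> no_triangle N (matrix ((!) x) N v)) \<longrightarrow>
       refutes N (matrix ((!) x) N v) v W)" for N v W
    proof (cases "well_formed ?n ((!) x) N v \<and> v < N")
      case True
      \<comment> \<open>Well-formedness confines the matrix positions to the word, where the two
        readings of its bits agree.\<close>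
      have M: "matrix ?X N v i j = matrix ((!) x) N v i j" if "i < N" "j < N" for i j
        unfolding matrix_def using True matrix_index[OF that] by (intro X) (auto simp: well_formed_def)
      have "simple_adj N (matrix ?X N v) = simple_adj N (matrix ((!) x) N v)"
        "no_triangle N (matrix ?X N v) = no_triangle N (matrix ((!) x) N v)"
        "refutes N (matrix ?X N v) v W = refutes N (matrix ((!) x) N v) v W"
        using True by (intro simple_adj_cong no_triangle_cong refutes_cong M; simp)+
      then show ?thesis using well_formed_cong[of ?n ?X "(!) x" N v] X by simp
    next
      case False
      then show ?thesis using well_formed_cong[of ?n ?X "(!) x" N v] X by blast
    qed
    then show ?thesis unfolding refutation_def by simp
  qed
  finally show ?thesis .
qed

lemma SHED_on_coNP:
  assumes C: "\<And>N A. simple_adj N A \<Longrightarrow> C (graph_of N A) \<longleftrightarrow> (tf \<longrightarrow> no_triangle N A)"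
  shows "SHED_on C \<in> class_coNP"
proof -
  have "x \<in> - SHED_on C \<longleftrightarrow>
     (\<exists>w. length w \<le> poly [:0, 1:] (length x) \<and> pair_code x w \<in> verifier tf)" for x
  proof -
    let ?n = "length x" and ?X = "(!) x"
    let ?ok = "\<lambda>N v. well_formed ?n ?X N v \<and> v < N \<and>
       simple_adj N (matrix ?X N v) \<and> (tf \<longrightarrow> no_triangle N (matrix ?X N v))"
    have bound: "N < Suc ?n \<and> v < Suc ?n" if "?ok N v" for N v
      using that by (auto simp: well_formed_def)
    have mem: "x \<in> - SHED_on C \<longleftrightarrow> (\<forall>N v. ?ok N v \<longrightarrow> (\<exists>W. refutes N (matrix ?X N v) v W))"
      unfolding Compl_iff SHED_on_iff using C by blast
    show ?thesis
    proof
      assume x: "x \<in> - SHED_on C"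
      show "\<exists>w. length w \<le> poly [:0, 1:] ?n \<and> pair_code x w \<in> verifier tf"
      proof (cases "\<exists>N v. ?ok N v")
        case True
        then obtain N v where ok: "?ok N v" by blast
        then obtain W where W: "refutes N (matrix ?X N v) v W" using x mem by blast
        \<comment> \<open>One bit per vertex; \<open>N\<close> is at most the length of the
          instance, so the identity polynomial bounds the certificate.\<close>
        define w where "w = map W [0..<N]"
        have bw: "bit_at w j \<longleftrightarrow> W j" if "j < N" for j using that by (simp add: w_def bit_at_def)
        have "refutes N (matrix ?X N v) v (\<lambda>j. bit_at w j)"
          using W refutes_cong[of v N "matrix ?X N v" "matrix ?X N v" "\<lambda>j. bit_at w j" W] bw ok
          by blast
        then have "refutation tf ?n ?X (\<lambda>j. bit_at w j)"
          unfolding refutation_def using ok well_formed_unique by blast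
        moreover have "length w \<le> ?n" using ok by (simp add: w_def well_formed_def)
        ultimately show ?thesis by (intro exI[of _ w]) (simp add: pair_code_in_verifier)
      next
        case False
        then have "refutation tf ?n ?X (\<lambda>j. bit_at [] j)" unfolding refutation_def by blast
        then show ?thesis by (intro exI[of _ "[]"]) (simp add: pair_code_in_verifier)
      qed
    next
      assume "\<exists>w. length w \<le> poly [:0, 1:] ?n \<and> pair_code x w \<in> verifier tf"
      then obtain w where "refutation tf ?n ?X (\<lambda>j. bit_at w j)"
        using pair_code_in_verifier by blast
      then show "x \<in> - SHED_on C" unfolding mem refutation_def using bound by blast
    qed
  qed
  then show ?thesis
    unfolding class_coNP_def class_NP_def using verifier_class_P[of tf] by blast
qed

section \<open>Clauses as a triangle-free graph\<close>

text \<open>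
  The vertex \<open>0\<close> is adjacent to all clauses, a clause to its literals (kind \<open>1\<close>: positive,
  kind \<open>2\<close>: negative) and a literal to its negation. An independent set that avoids the
  neighbours of \<open>0\<close> and dominates them is a partial assignment satisfying all clauses.
\<close>

definition clause_arc ::
  "(nat \<Rightarrow> nat) \<Rightarrow> (nat \<Rightarrow> 'f) \<Rightarrow> (nat \<Rightarrow> bool) \<Rightarrow> (nat \<Rightarrow> 'f \<Rightarrow> bool) \<Rightarrow> (nat \<Rightarrow> 'f \<Rightarrow> bool) \<Rightarrow> nat \<Rightarrow> nat \<Rightarrow> bool"
  where "clause_arc kind fct cl P Q u w \<longleftrightarrow>
     u = 0 \<and> kind w = 3 \<and> cl w \<or>
     kind u = 1 \<and> kind w = 2 \<and> fct u = fct w \<or>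
     kind u = 3 \<and> cl u \<and> kind w = 1 \<and> P u (fct w) \<or>
     kind u = 3 \<and> cl u \<and> kind w = 2 \<and> Q u (fct w)"

definition clause_adj where
  "clause_adj kind fct cl P Q u w \<longleftrightarrow> clause_arc kind fct cl P Q u w \<or> clause_arc kind fct cl P Q w u"

text \<open>A literal may be represented by several vertices; \<open>rep\<close> asks for at least
  one vertex for either sign of each fact that occurs in a clause.\<close>

locale clause_graph =
  fixes n :: nat and kind :: "nat \<Rightarrow> nat" and fct :: "nat \<Rightarrow> 'f" and cl :: "nat \<Rightarrow> bool"
    and P Q :: "nat \<Rightarrow> 'f \<Rightarrow> bool"
  assumes kind0: "kind 0 = 0"
    and not_both: "\<And>u f. cl u \<Longrightarrow> P u f \<Longrightarrow> \<not> Q u f"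
    and rep: "\<And>u f k. u < n \<Longrightarrow> kind u = 3 \<Longrightarrow> cl u \<Longrightarrow> P u f \<or> Q u f \<Longrightarrow> k = 1 \<or> k = 2 \<Longrightarrow>
       \<exists>w<n. kind w = k \<and> fct w = f"
begin

abbreviation "arc \<equiv> clause_arc kind fct cl P Q"
abbreviation "adj \<equiv> clause_adj kind fct cl P Q"

lemma adj_cases:
  assumes "adj u w"
  obtains "u = 0" "kind w = 3" "cl w" | "w = 0" "kind u = 3" "cl u"
    | "kind u = 1" "kind w = 2" "fct u = fct w" | "kind w = 1" "kind u = 2" "fct u = fct w"
    | "kind u = 3" "cl u" "kind w = 1" "P u (fct w)" | "kind w = 3" "cl w" "kind u = 1" "P w (fct u)"
    | "kind u = 3" "cl u" "kind w = 2" "Q u (fct w)" | "kind w = 3" "cl w" "kind u = 2" "Q w (fct u)"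
  using assms unfolding clause_adj_def clause_arc_def by metis

lemma simple_adj_clause: "simple_adj n adj"
  unfolding simple_adj_def
proof (intro conjI allI impI)
  fix i show "\<not> adj i i"
    using kind0 by (auto simp: clause_adj_def clause_arc_def)
next
  fix i j assume "adj i j" then show "adj j i" by (auto simp: clause_adj_def)
qed

text \<open>Vertex \<open>0\<close> has neighbours of kind \<open>3\<close> only, and no two
  vertices of equal kind are adjacent. A triangle would thus consist of a clause and two
  complementary literals in it, contrary to \<open>not_both\<close>.\<close>

lemma no_triangle_clause: "no_triangle n adj"
  unfolding no_triangle_def
proof (intro allI impI notI, elim conjE)
  fix a b c assume abc: "adj a b" "adj b c" "adj c a"
  show False
    using abc(1)
    by (cases rule: adj_cases; cases rule: adj_cases[OF abc(2)]; cases rule: adj_cases[OF abc(3)])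
      (use kind0 not_both in auto)
qed

lemma refutes_clause_iff:
  "(\<exists>W. refutes n adj 0 W) \<longleftrightarrow>
   (\<exists>\<tau>. \<forall>u<n. kind u = 3 \<and> cl u \<longrightarrow> (\<exists>f. P u f \<and> \<tau> f) \<or> (\<exists>f. Q u f \<and> \<not> \<tau> f))"
proof
  assume "\<exists>W. refutes n adj 0 W"
  then obtain W where W0: "\<And>j. j < n \<Longrightarrow> W j \<Longrightarrow> j \<noteq> 0 \<and> \<not> adj 0 j"
    and ind: "\<And>i j. i < n \<Longrightarrow> j < n \<Longrightarrow> W i \<Longrightarrow> W j \<Longrightarrow> \<not> adj i j"
    and dom: "\<And>u. u < n \<Longrightarrow> adj 0 u \<Longrightarrow> \<exists>s<n. W s \<and> adj u s"
    unfolding refutes_def by blast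
  \<comment> \<open>A fact with neither literal chosen becomes false. So does one whose negative
    literal is chosen, because that vertex is adjacent to every copy of the positive one.\<close>
  define \<tau> where "\<tau> = (\<lambda>f. \<exists>w<n. W w \<and> kind w = 1 \<and> fct w = f)"
  have "(\<exists>f. P u f \<and> \<tau> f) \<or> (\<exists>f. Q u f \<and> \<not> \<tau> f)" if u: "u < n" "kind u = 3" "cl u" for u
  proof -
    have "adj 0 u" using u by (auto simp: clause_adj_def clause_arc_def)
    then obtain s where s: "s < n" "W s" "adj u s" using dom u by blast
    have "s \<noteq> 0" using W0 s by blast
    from s(3) show ?thesis
    proof (cases rule: adj_cases)
      case 5
      then have "\<tau> (fct s)" using s unfolding \<tau>_def by blast
      then show ?thesis using 5 by blast
    next
      case 7
      have "\<not> \<tau> (fct s)"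
      proof
        assume "\<tau> (fct s)"
        then obtain w where w: "w < n" "W w" "kind w = 1" "fct w = fct s" unfolding \<tau>_def by blast
        then have "adj w s" using 7 by (auto simp: clause_adj_def clause_arc_def)
        then show False using ind w s by blast
      qed
      then show ?thesis using 7 by blast
    qed (use u \<open>s \<noteq> 0\<close> kind0 in auto)
  qed
  then show "\<exists>\<tau>. \<forall>u<n. kind u = 3 \<and> cl u \<longrightarrow> (\<exists>f. P u f \<and> \<tau> f) \<or> (\<exists>f. Q u f \<and> \<not> \<tau> f)"
    by blast
next
  assume "\<exists>\<tau>. \<forall>u<n. kind u = 3 \<and> cl u \<longrightarrow> (\<exists>f. P u f \<and> \<tau> f) \<or> (\<exists>f. Q u f \<and> \<not> \<tau> f)"
  then obtain \<tau> where \<tau>: "\<And>u. u < n \<Longrightarrow> kind u = 3 \<Longrightarrow> cl u \<Longrightarrow> (\<exists>f. P u f \<and> \<tau> f) \<or> (\<exists>f. Q u f \<and> \<not> \<tau> f)"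
    by blast
  define W where "W = (\<lambda>w. kind w = 1 \<and> \<tau> (fct w) \<or> kind w = 2 \<and> \<not> \<tau> (fct w))"
  have "refutes n adj 0 W"
    unfolding refutes_def
  proof (intro conjI allI impI)
    fix j assume "W j"
    then show "j \<noteq> 0" using kind0 by (cases "j = 0") (auto simp: W_def)
    show "\<not> adj 0 j"
    proof
      assume "adj 0 j"
      then show False by (cases rule: adj_cases) (use kind0 \<open>W j\<close> in \<open>auto simp: W_def\<close>)
    qed
  next
    fix i j assume W: "W i \<and> W j"
    show "\<not> adj i j"
    proof
      assume "adj i j"
      then show False by (cases rule: adj_cases) (use kind0 W in \<open>auto simp: W_def\<close>)
    qed
  next
    fix u assume u: "u < n" "adj 0 u"
    from u(2) have cl: "kind u = 3" "cl u"
      by (cases rule: adj_cases; use kind0 in auto)+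
    from \<tau>[OF u(1) cl] show "\<exists>s<n. W s \<and> adj u s"
    proof (elim disjE exE conjE)
      fix f assume f: "P u f" "\<tau> f"
      then obtain w where "w < n" "kind w = 1" "fct w = f" using rep[OF u(1) cl, of f 1] by auto
      then show ?thesis using f cl by (intro exI[of _ w]) (auto simp: W_def clause_adj_def clause_arc_def)
    next
      fix f assume f: "Q u f" "\<not> \<tau> f"
      then obtain w where "w < n" "kind w = 2" "fct w = f" using rep[OF u(1) cl, of f 2] by auto
      then show ?thesis using f cl by (intro exI[of _ w]) (auto simp: W_def clause_adj_def clause_arc_def)
    qed
  qed
  then show "\<exists>W. refutes n adj 0 W" by blast
qed

end

section \<open>Numbers as digit vectors\<close>

definition digit :: "nat \<Rightarrow> nat \<Rightarrow> nat \<Rightarrow> nat" where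
  "digit b j u = u div b ^ j mod b"

lemma digit_surj:
  "\<forall>d\<in>set ds. d < b \<Longrightarrow> \<exists>u < b ^ length ds. \<forall>j < length ds. digit b j u = ds ! j"
proof (induction ds)
  case (Cons d ds)
  then obtain u where u: "u < b ^ length ds" "\<forall>j < length ds. digit b j u = ds ! j" by auto
  have d: "d < b" using Cons by simp
  have "digit b j (d + b * u) = (d # ds) ! j" if "j < Suc (length ds)" for j
  proof (cases j)
    case 0
    then show ?thesis using d by (simp add: digit_def)
  next
    case (Suc i)
    have "(d + b * u) div b ^ Suc i = ((d + b * u) div b) div b ^ i"
      by (simp add: div_mult2_eq)
    also have "(d + b * u) div b = u" using d by simp
    finally show ?thesis using u(2) that Suc by (simp add: digit_def)
  qed
  moreover have "d + b * u < b ^ length (d # ds)"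
    using d mult_le_mono2[of "Suc u" "b ^ length ds" b] u(1) by simp
  ultimately show ?case by (intro exI[of _ "d + b * u"]) auto
qed simp

section \<open>Runs of Turing machines\<close>

text \<open>Seen from its head, a tape shifts against the movement: column \<open>i\<close> becomes
  column \<open>i + mcode d - 1\<close>, with no negative values for
  \<open>1 \<le> i\<close>.\<close>

fun mcode :: "move \<Rightarrow> nat" where
  "mcode Left = 2" | "mcode Stay = 1" | "mcode Right = 0"

lemma shift_mcode: "shift d h = h + 1 - int (mcode d)"
  by (cases d) auto

lemma mcode_le: "mcode d \<le> 2"
  by (cases d) auto

text \<open>Halting becomes a self-loop that rewrites the symbols read, so the tableau can have the
  same height for every run.\<close>

definition trans :: "tm \<Rightarrow> nat \<Rightarrow> nat list \<Rightarrow> nat \<times> (nat \<times> move) list" where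
  "trans M s rs = (if s < nstates M then delta M s rs else (s, map (\<lambda>a. (a, Stay)) rs))"

lemma tm_step_trans:
  "tm_step M (s, ts) = (fst (trans M s (map head_symbol ts)), map2 act (snd (trans M s (map head_symbol ts))) ts)"
proof (cases "s < nstates M")
  case False
  have "map2 act (map (\<lambda>a. (a, Stay)) (map head_symbol ts)) ts = ts"
    by (induction ts) auto
  then show ?thesis using False by (simp add: trans_def)
qed (simp add: trans_def split: prod.split)

lemma trans_bounds:
  assumes "wf_tm M" "s \<le> nstates M" "length rs = ntapes M" "set rs \<subseteq> {..<nsymbols M}"
  shows "fst (trans M s rs) \<le> nstates M" "length (snd (trans M s rs)) = ntapes M"
    "k < ntapes M \<Longrightarrow> fst (snd (trans M s rs) ! k) < nsymbols M"
proof -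
  have *: "fst (trans M s rs) \<le> nstates M \<and> length (snd (trans M s rs)) = ntapes M \<and>
     fst ` set (snd (trans M s rs)) \<subseteq> {..<nsymbols M}"
  proof (cases "s < nstates M")
    case True
    have "\<forall>s < nstates M. \<forall>rs. length rs = ntapes M \<and> set rs \<subseteq> {..<nsymbols M} \<longrightarrow>
        (case delta M s rs of (s', as) \<Rightarrow>
           s' \<le> nstates M \<and> length as = ntapes M \<and> fst ` set as \<subseteq> {..<nsymbols M})"
      using assms(1) unfolding wf_tm_def by (elim conjE)
    from this[rule_format, OF True conjI[OF assms(3,4)]]
    show ?thesis using True by (simp add: trans_def split: prod.splits)
  next
    case False
    then show ?thesis using assms by (auto simp: trans_def)
  qed
  then show "fst (trans M s rs) \<le> nstates M" "length (snd (trans M s rs)) = ntapes M" by auto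
  show "fst (snd (trans M s rs) ! k) < nsymbols M" if "k < ntapes M"
    using * that nth_mem[of k "snd (trans M s rs)"] by fastforce
qed

definition run :: "tm \<Rightarrow> bool list \<Rightarrow> nat \<Rightarrow> config" where
  "run M z t = (tm_step M ^^ t) (init_config M z)"

definition ok_config :: "tm \<Rightarrow> nat \<Rightarrow> config \<Rightarrow> bool" where
  "ok_config M t c \<longleftrightarrow> fst c \<le> nstates M \<and> length (snd c) = ntapes M \<and>
     (\<forall>k < ntapes M. \<bar>snd (snd c ! k)\<bar> \<le> int t \<and> (\<forall>i. fst (snd c ! k) i < nsymbols M))"

lemma act_fst: "fst (act a tp) = (fst tp)(snd tp := fst a)"
  by (cases a; cases tp) auto

lemma act_snd: "snd (act a tp) = snd tp + 1 - int (mcode (snd a))"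
  by (cases a; cases tp) (auto simp: shift_mcode)

lemma head_symbol_conv: "head_symbol tp = fst tp (snd tp)"
  by (cases tp) auto

lemma ok_config_reads:
  assumes "ok_config M t (s, ts)"
  shows "length (map head_symbol ts) = ntapes M" "set (map head_symbol ts) \<subseteq> {..<nsymbols M}"
proof -
  show "length (map head_symbol ts) = ntapes M" using assms by (simp add: ok_config_def)
  show "set (map head_symbol ts) \<subseteq> {..<nsymbols M}"
  proof
    fix a assume "a \<in> set (map head_symbol ts)"
    then obtain k where "k < length ts" "a = head_symbol (ts ! k)"
      by (metis in_set_conv_nth length_map nth_map)
    then show "a \<in> {..<nsymbols M}" using assms by (simp add: ok_config_def head_symbol_conv)
  qed
qed

lemma ok_config_step:
  assumes wf: "wf_tm M" and ok: "ok_config M t (s, ts)"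
  shows "ok_config M (Suc t) (tm_step M (s, ts))"
proof -
  let ?tr = "trans M s (map head_symbol ts)"
  have s: "s \<le> nstates M" and len: "length ts = ntapes M" using ok by (auto simp: ok_config_def)
  note tb = trans_bounds[OF wf s ok_config_reads[OF ok]]
  have nth: "map2 act (snd ?tr) ts ! k = act (snd ?tr ! k) (ts ! k)" if "k < ntapes M" for k
    using that tb(2) len by simp
  have old: "\<bar>snd (ts ! k)\<bar> \<le> int t" "fst (ts ! k) i < nsymbols M" if "k < ntapes M" for k i
    using ok that by (auto simp: ok_config_def)
  have "\<bar>snd (act (snd ?tr ! k) (ts ! k))\<bar> \<le> int (Suc t)" if "k < ntapes M" for k
    using old(1)[OF that] mcode_le[of "snd (snd ?tr ! k)"] by (simp add: act_snd)
  then show ?thesis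
    unfolding tm_step_trans using tb len old by (simp add: ok_config_def nth act_fst)
qed

lemma ok_config_run:
  assumes wf: "wf_tm M"
  shows "ok_config M t (run M z t)"
proof (induction t)
  case 0
  have "nsymbols M \<ge> 3" "ntapes M \<ge> 1" using wf by (auto simp: wf_tm_def)
  then show ?case
    by (auto simp: run_def ok_config_def init_config_def nth_Cons' blank_tape_def input_tape_def bit_symbol_def)
next
  case (Suc t)
  then show ?case using ok_config_step[OF wf, of t "fst (run M z t)" "snd (run M z t)"]
    by (simp add: run_def)
qed

lemma run_Suc_nth:
  assumes wf: "wf_tm M" and k: "k < ntapes M"
  shows "fst (run M z (Suc t)) = fst (trans M (fst (run M z t)) (map head_symbol (snd (run M z t))))"
    "snd (run M z (Suc t)) ! k =
      act (snd (trans M (fst (run M z t)) (map head_symbol (snd (run M z t)))) ! k) (snd (run M z t) ! k)"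
proof -
  obtain s ts where st: "run M z t = (s, ts)" by fastforce
  have ok: "ok_config M t (s, ts)" using ok_config_run[OF wf, of t z] st by simp
  then have s: "s \<le> nstates M" and len: "length ts = ntapes M" by (auto simp: ok_config_def)
  have Suc: "run M z (Suc t) = tm_step M (s, ts)" using st by (simp add: run_def)
  show "fst (run M z (Suc t)) = fst (trans M (fst (run M z t)) (map head_symbol (snd (run M z t))))"
    unfolding Suc tm_step_trans st by simp
  show "snd (run M z (Suc t)) ! k =
      act (snd (trans M (fst (run M z t)) (map head_symbol (snd (run M z t)))) ! k) (snd (run M z t) ! k)"
    unfolding Suc tm_step_trans st
    using trans_bounds(2)[OF wf s ok_config_reads[OF ok]] k len by simp
qed

lemma run_halted:
  assumes "fst (run M z t) = nstates M" "t \<le> t'"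
  shows "run M z t' = run M z t"
  using assms(2)
proof (induction t' rule: dec_induct)
  case (step t')
  have "tm_step M (run M z t) = run M z t"
    using assms(1) by (cases "run M z t") simp
  then show ?case using step by (simp add: run_def)
qed simp

lemma accepts_run:
  assumes "wf_tm M" "computes_in_time M (\<lambda>z. [z \<in> V]) (poly p)" "poly p (length z) \<le> t"
  shows "fst (snd (run M z t) ! (ntapes M - 1)) 0 = 2 \<longleftrightarrow> z \<in> V"
proof -
  obtain t0 where t0: "t0 \<le> poly p (length z)" "fst (run M z t0) = nstates M"
      "holds_output (last (snd (run M z t0))) [z \<in> V]"
    using assms(2) unfolding computes_in_time_def run_def case_prod_beta by blast
  have "run M z t = run M z t0" by (rule run_halted[OF t0(2)]) (use t0(1) assms(3) in simp)
  moreover have "last (snd (run M z t0)) = snd (run M z t0) ! (ntapes M - 1)"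
    using ok_config_run[OF assms(1), of t0 z] assms(1)
    by (subst last_conv_nth) (auto simp: ok_config_def wf_tm_def)
  ultimately have "holds_output (snd (run M z t) ! (ntapes M - 1)) [z \<in> V]" using t0(3) by simp
  then show ?thesis by (simp add: holds_output_def bit_symbol_def)
qed

section \<open>The clauses of a computation\<close>

text \<open>
  The facts \<open>(t, k, i, a)\<close> say that at time \<open>t\<close> cell \<open>i\<close> of track \<open>k\<close> contains \<open>a\<close>. The tracks below
  \<open>K\<close> are the tapes, shifted such that the head is at cell \<open>R\<close>. Track \<open>K\<close> has the state in cell
  \<open>R\<close>, track \<open>K + 1\<close> moves with the last tape and has a \<open>1\<close> at the origin of that tape. Track
  \<open>K + 2\<close> has in cell \<open>R\<close> the index in \<open>combos\<close> of the list of the symbols read and the state.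
  Apart from the choice of the certificate, all clauses are Horn clauses, so that a satisfying
  assignment makes at least the facts of an actual run true; no clause has to exclude further facts.
\<close>

locale tableau_defs =
  fixes M :: tm and p q :: "nat poly"
begin

definition K :: nat where "K = ntapes M"
definition width :: nat where "width = max (nsymbols M) (Suc (nstates M))"
definition combos :: "nat list list" where "combos = List.n_lists (Suc K) [0..<width]"
definition C :: nat where "C = length combos"
definition certlen :: "bool list \<Rightarrow> nat" where "certlen x = poly q (length x)"
text \<open>The argument of \<open>p\<close> is the length of the pair code with a certificate of
  maximal length.\<close>

definition T :: "bool list \<Rightarrow> nat" where "T x = poly p (2 * length x + 2 + certlen x)"
text \<open>Knowledge is lost by one column at either margin per step, leaving columns
  \<open>T x + 1\<close> to \<open>3 * T x + 1\<close> at the end. These are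
  \<open>R x - T x\<close> to \<open>R x + T x\<close>, just where the origin can have
  drifted.\<close>

definition R :: "bool list \<Rightarrow> nat" where "R x = 2 * T x + 1"
text \<open>A common base for all digits, above every time, track, column, symbol, state, index into
  \<open>combos\<close>, vertex kind and rule number in use.\<close>

definition B :: "bool list \<Rightarrow> nat" where
  "B x = 2 * R x + 2 * length x + certlen x + C + width + K + 10"
definition lo :: "bool list \<Rightarrow> nat" where "lo x = R x + 2 * length x + 2"
definition hi :: "bool list \<Rightarrow> nat" where "hi x = lo x + certlen x"

definition result :: "nat \<Rightarrow> nat \<times> (nat \<times> move) list" where
  "result c = trans M (combos ! c ! K) (take K (combos ! c))"

definition sy :: "nat \<Rightarrow> nat \<Rightarrow> nat" where
  "sy c k = (if c < C \<and> k < K + 1 then combos ! c ! k else 0)"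

text \<open>The bound \<open>width\<close> only matters for lists in \<open>combos\<close> that do not occur in any run.\<close>

definition wr :: "nat \<Rightarrow> nat \<Rightarrow> nat" where
  "wr c k = (if c < C \<and> k < K + 1
     then min width (if k < K then fst (snd (result c) ! k) else fst (result c)) else 0)"

text \<open>The state track \<open>K\<close> stays in place, and \<open>min k (K - 1)\<close> makes
  track \<open>K + 1\<close> move with the last tape.\<close>

definition mv :: "nat \<Rightarrow> nat \<Rightarrow> nat" where
  "mv c k = (if c < C \<and> k < K + 2
     then (if k = K then 1 else mcode (snd (snd (result c) ! min k (K - 1)))) else 0)"

text \<open>The doubled input, then the separator as tape symbols \<open>1\<close> and
  \<open>2\<close>. The default \<open>0\<close> is the blank and, on the state track, the initial
  state.\<close>

definition ini :: "bool list \<Rightarrow> nat \<Rightarrow> nat \<Rightarrow> nat" where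
  "ini x k i =
     (if k = 0 \<and> R x \<le> i \<and> i < R x + 2 * length x then if bit_at x ((i - R x) div 2) then 2 else 1
      else if k = 0 \<and> i = R x + 2 * length x then 1
      else if k = 0 \<and> i = R x + 2 * length x + 1 then 2
      else if k = K + 1 \<and> i = R x then 1 else 0)"

text \<open>Rule \<open>0\<close> collects what is read into an index, \<open>1\<close> performs a
  step, \<open>2\<close> fixes the initial cells outside the certificate, \<open>3\<close> chooses a
  certificate cell, \<open>4\<close> propagates blanks to the right, \<open>5\<close> forbids a
  final symbol other than \<open>2\<close> at the origin. A rule that ignores a parameter merely
  occurs repeatedly.\<close>

definition clause :: "bool list \<Rightarrow> nat \<Rightarrow> nat \<Rightarrow> nat \<Rightarrow> nat \<Rightarrow> nat \<Rightarrow> nat \<Rightarrow> bool" where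
  "clause x r t c k i b \<longleftrightarrow> t \<le> T x \<and> c < C \<and> k \<le> K + 1 \<and> i < B x \<and> b < B x \<and>
     (r = 0 \<and> t < T x \<or> r = 1 \<and> t < T x \<and> 1 \<le> i \<and> i + 1 < B x \<or>
      r = 2 \<and> \<not> (k = 0 \<and> lo x \<le> i \<and> i < hi x) \<or> r = 3 \<and> lo x \<le> i \<and> i < hi x \<or>
      r = 4 \<and> lo x \<le> i \<and> i + 1 < hi x \<or> r = 5 \<and> b \<noteq> 2)"

definition pos :: "bool list \<Rightarrow> nat \<Rightarrow> nat \<Rightarrow> nat \<Rightarrow> nat \<Rightarrow> nat \<Rightarrow> nat \<Rightarrow> nat \<times> nat \<times> nat \<times> nat \<Rightarrow> bool" where
  "pos x r t c k i b = (\<lambda>(t', k', i', a').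
     r = 0 \<and> t' = t \<and> k' = K + 2 \<and> i' = R x \<and> a' = c \<or>
     r = 1 \<and> t' = t + 1 \<and> k' = k \<and> i' = i + mv c k - 1 \<and>
       a' = (if i = R x \<and> k \<le> K then wr c k else b) \<or>
     r = 2 \<and> t' = 0 \<and> k' = k \<and> i' = i \<and> a' = ini x k i \<or>
     r = 3 \<and> t' = 0 \<and> k' = 0 \<and> i' = i \<and> a' \<le> 2 \<or>
     r = 4 \<and> t' = 0 \<and> k' = 0 \<and> i' = i + 1 \<and> a' = 0)"

definition neg :: "bool list \<Rightarrow> nat \<Rightarrow> nat \<Rightarrow> nat \<Rightarrow> nat \<Rightarrow> nat \<Rightarrow> nat \<Rightarrow> nat \<times> nat \<times> nat \<times> nat \<Rightarrow> bool" where
  "neg x r t c k i b = (\<lambda>(t', k', i', a').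
     r = 0 \<and> t' = t \<and> k' \<le> K \<and> i' = R x \<and> a' = sy c k' \<or>
     r = 1 \<and> t' = t \<and> (k' = K + 2 \<and> i' = R x \<and> a' = c \<or> k' = k \<and> i' = i \<and> a' = b) \<or>
     r = 4 \<and> t' = 0 \<and> k' = 0 \<and> i' = i \<and> a' = 0 \<or>
     r = 5 \<and> t' = T x \<and> i' = i \<and> (k' = K + 1 \<and> a' = 1 \<or> k' = K - 1 \<and> a' = b))"

definition sat :: "bool list \<Rightarrow> (nat \<times> nat \<times> nat \<times> nat \<Rightarrow> bool) \<Rightarrow> bool" where
  "sat x \<tau> \<longleftrightarrow> (\<forall>r t c k i b. clause x r t c k i b \<longrightarrow>
     (\<exists>f. pos x r t c k i b f \<and> \<tau> f) \<or> (\<exists>f. neg x r t c k i b f \<and> \<not> \<tau> f))"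

section \<open>The facts of an actual run\<close>

definition vec :: "bool list \<Rightarrow> nat \<Rightarrow> nat list" where
  "vec z t = map head_symbol (snd (run M z t)) @ [fst (run M z t)]"

definition com :: "bool list \<Rightarrow> nat \<Rightarrow> nat" where
  "com z t = (SOME c. c < C \<and> combos ! c = vec z t)"

text \<open>With the heads drawn in column \<open>s\<close>, column \<open>i\<close> shows the cell
  whose absolute position is the head position plus \<open>i - s\<close>; track \<open>K + 1\<close>
  asks whether that position is \<open>0\<close>.\<close>

definition val :: "bool list \<Rightarrow> nat \<Rightarrow> nat \<Rightarrow> nat \<Rightarrow> nat \<Rightarrow> nat" where
  "val z s t k i =
     (if k < K then fst (snd (run M z t) ! k) (snd (snd (run M z t) ! k) + int i - int s)
      else if k = K then (if i = s then fst (run M z t) else 0)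
      else of_bool (snd (snd (run M z t) ! (K - 1)) + int i = int s))"

lemma wr_bound: "wr c k < B x"
  by (simp add: wr_def B_def min_def)

lemma mv_bound: "mv c k \<le> 2"
  by (simp add: mv_def mcode_le)

lemma set_combos: "set combos = {ys. length ys = Suc K \<and> set ys \<subseteq> {0..<width}}"
  by (simp only: combos_def set_n_lists set_upt)

lemma distinct_combos: "distinct combos"
  unfolding combos_def by (intro distinct_n_lists distinct_upt)

lemma sy_bound: "sy c k < B x"
proof (cases "c < C \<and> k < K + 1")
  case True
  then have "combos ! c \<in> set combos" by (simp add: C_def)
  then have "length (combos ! c) = Suc K" "set (combos ! c) \<subseteq> {0..<width}"
    by (auto simp: set_combos)
  then have "combos ! c ! k < width"
    using True nth_mem[of k "combos ! c"] by (auto simp: subset_iff)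
  then show ?thesis using True by (simp add: sy_def B_def)
qed (auto simp: sy_def B_def)

lemma ini_bound: "ini x k i \<le> 2"
  by (simp add: ini_def)

lemma B_bounds: "R x < B x" "K + 2 < B x" "C < B x" "T x < B x" "hi x \<le> B x" "9 < B x" "2 * R x < B x"
  by (simp_all add: B_def R_def hi_def lo_def)

lemma clause_bound:
  assumes "clause x r t c k i b"
  shows "r < B x" "t < B x" "c < B x" "k < B x" "i < B x" "b < B x"
  using assms B_bounds[of x] by (auto simp: clause_def)

lemma pos_bound:
  assumes "clause x r t c k i b" "pos x r t c k i b (t', k', i', a')"
  shows "t' < B x" "k' < B x" "i' < B x" "a' < B x"
  using assms B_bounds[of x] wr_bound[of c k x] mv_bound[of c k] ini_bound[of x k i]
  by (auto simp: clause_def pos_def)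

lemma neg_bound:
  assumes "clause x r t c k i b" "neg x r t c k i b (t', k', i', a')"
  shows "t' < B x" "k' < B x" "i' < B x" "a' < B x"
  using assms B_bounds[of x] sy_bound[of c k' x] by (auto simp: clause_def neg_def)

text \<open>Conclusion and premises differ in the track for rule \<open>0\<close>, in the time for
  rule \<open>1\<close>, in the column for rule \<open>4\<close>; the other rules have literals of
  one sign only. This is what keeps triangles out of the graph.\<close>

lemma not_pos_neg: "pos x r t c k i b f \<Longrightarrow> \<not> neg x r t c k i b f"
  by (cases f) (auto simp: pos_def neg_def)

end

locale tableau = tableau_defs +
  assumes wf: "wf_tm M"
begin

lemma K_pos: "0 < K"
  using wf by (simp add: K_def wf_tm_def)

lemma run_ok:
  "fst (run M z t) \<le> nstates M" "length (snd (run M z t)) = K"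
  "k < K \<Longrightarrow> \<bar>snd (snd (run M z t) ! k)\<bar> \<le> int t"
  "k < K \<Longrightarrow> fst (snd (run M z t) ! k) i < nsymbols M"
  using ok_config_run[OF wf, of t z] by (auto simp: ok_config_def K_def)

lemma vec_nth: "k \<le> K \<Longrightarrow> vec z t ! k = val z s t k s"
  using run_ok(2)[of z t] by (auto simp: vec_def val_def nth_append head_symbol_conv)

lemma com: "com z t < C" "combos ! com z t = vec z t"
proof -
  have "a < width" if a: "a \<in> set (vec z t)" for a
  proof (cases "a = fst (run M z t)")
    case True
    then show ?thesis using run_ok(1)[of z t] by (simp add: width_def)
  next
    case False
    then obtain k where "k < K" "a = head_symbol (snd (run M z t) ! k)"
      using a run_ok(2)[of z t] by (auto simp: vec_def in_set_conv_nth)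
    then have "a < nsymbols M" using run_ok(4) by (simp add: head_symbol_conv)
    then show ?thesis by (simp add: width_def)
  qed
  moreover have "length (vec z t) = Suc K" by (simp add: vec_def run_ok)
  ultimately have "vec z t \<in> set combos" by (auto simp: set_combos)
  then have "\<exists>c. c < C \<and> combos ! c = vec z t" by (simp add: C_def in_set_conv_nth)
  from someI_ex[OF this] show "com z t < C" "combos ! com z t = vec z t"
    unfolding com_def by blast+
qed

lemma sy_com: "k \<le> K \<Longrightarrow> sy (com z t) k = val z s t k s"
  using com[of z t] vec_nth[of k z t s] by (simp add: sy_def)

lemma com_unique:
  assumes "c < C" "\<And>k. k \<le> K \<Longrightarrow> sy c k = val z s t k s"
  shows "c = com z t"
proof -
  have "combos ! c \<in> set combos" using assms(1) by (simp add: C_def)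
  then have "length (combos ! c) = Suc K" by (simp add: set_combos)
  moreover have "length (vec z t) = Suc K" by (simp add: vec_def run_ok)
  ultimately have "combos ! c = vec z t"
    using assms vec_nth[of _ z t s] by (intro nth_equalityI) (auto simp: sy_def less_Suc_eq_le)
  then have "combos ! c = combos ! com z t" using com by simp
  then show ?thesis
    using com(1)[of z t] assms(1) distinct_combos by (simp add: nth_eq_iff_index_eq C_def)
qed

lemma result_com: "result (com z t) = trans M (fst (run M z t)) (map head_symbol (snd (run M z t)))"
  unfolding result_def com(2) using run_ok(2)[of z t] by (simp add: vec_def nth_append)

lemma wr_com:
  "k < K \<Longrightarrow> wr (com z t) k = fst (snd (result (com z t)) ! k)"
  "wr (com z t) K = fst (result (com z t))"
proof -
  obtain s ts where st: "run M z t = (s, ts)" by fastforce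
  have ok: "ok_config M t (s, ts)" using ok_config_run[OF wf, of t z] st by simp
  then have s: "s \<le> nstates M" by (simp add: ok_config_def)
  note tb = trans_bounds[OF wf s ok_config_reads[OF ok]]
  show "wr (com z t) K = fst (result (com z t))"
    using tb(1) com(1)[of z t] by (simp add: wr_def result_com st width_def)
  show "wr (com z t) k = fst (snd (result (com z t)) ! k)" if "k < K"
    using tb(3)[of k] that com(1)[of z t] by (simp add: wr_def result_com st width_def K_def)
qed

lemma val_Suc:
  assumes "k \<le> K + 1" "1 \<le> i"
  shows "val z s (Suc t) k (i + mv (com z t) k - 1)
    = (if i = s \<and> k \<le> K then wr (com z t) k else val z s t k i)"
proof -
  let ?c = "com z t"
  have tape: "snd (run M z (Suc t)) ! j = act (snd (result ?c) ! j) (snd (run M z t) ! j)" if "j < K" for j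
    using run_Suc_nth(2)[OF wf, of j z t] that by (simp add: result_com K_def)
  have state: "fst (run M z (Suc t)) = fst (result ?c)"
    using run_Suc_nth(1)[OF wf, of 0 z t] K_pos by (simp add: result_com K_def)
  \<comment> \<open>The column shift cancels the head movement, so the same absolute cell is looked
    at before and after the step.\<close>
  have head: "snd (snd (run M z (Suc t)) ! j) + int (i + mv ?c k - 1) = snd (snd (run M z t) ! j) + int i"
    if "j < K" "mv ?c k = mcode (snd (snd (result ?c) ! j))" for j
    using that assms(2) by (simp add: tape act_snd)
  consider "k < K" | "k = K" | "k = K + 1" using assms by linarith
  then show ?thesis
  proof cases
    case 1
    then have "mv ?c k = mcode (snd (snd (result ?c) ! k))" using com(1)[of z t] by (simp add: mv_def min_absorb1)
    from head[OF 1 this] 1 show ?thesis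
      by (simp add: val_def tape act_fst wr_com)
  next
    case 2
    then show ?thesis using com(1)[of z t] by (simp add: val_def mv_def state wr_com)
  next
    case 3
    then have "mv ?c k = mcode (snd (snd (result ?c) ! (K - 1)))" using com(1)[of z t] by (simp add: mv_def)
    from head[OF _ this] 3 K_pos show ?thesis by (simp add: val_def)
  qed
qed

lemma val_0:
  assumes "k \<le> K + 1"
  shows "val (pair_code x w) (R x) 0 k i =
    (if k = 0 \<and> lo x \<le> i \<and> i < lo x + length w then bit_symbol (w ! (i - lo x)) else ini x k i)"
proof -
  let ?z = "pair_code x w" and ?n = "length x"
  have init: "run M ?z 0 = (0, input_tape ?z # replicate (K - 1) blank_tape)"
    by (simp add: run_def init_config_def K_def)
  consider "k = 0" | "0 < k" "k < K" | "k = K" | "k = K + 1" using assms by linarith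
  then show ?thesis
  proof cases
    case 1
    have v: "val ?z (R x) 0 k i = in_sym ?z (int i - int (R x))"
      using 1 K_pos by (simp add: val_def init input_tape_def)
    show ?thesis
    proof (cases "R x \<le> i")
      case False
      then show ?thesis using 1 unfolding v by (simp add: input_tape_def ini_def lo_def)
    next
      case True
      then obtain j where i: "i = R x + j" using le_Suc_ex by blast
      have v': "val ?z (R x) 0 k i = (if j < length ?z then bit_symbol (?z ! j) else 0)"
        unfolding v unfolding i by (simp add: input_tape_def)
      consider "j < 2 * ?n" | "j = 2 * ?n" | "j = 2 * ?n + 1" | l where "j = Suc (Suc (2 * ?n + l))"
        by (metis Suc_eq_plus1 add_Suc less_iff_Suc_add less_SucI linorder_neqE_nat not_less_eq)
      then show ?thesis
      proof cases
        case A: 1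
        have "?z ! j = x ! (j div 2)"
          using nth_pair_code(1,2)[of "j div 2" x w] A
          by (cases "even j") (auto elim!: evenE oddE)
        then show ?thesis using A 1 unfolding v' unfolding i
          by (auto simp: ini_def lo_def bit_symbol_def bit_at_def)
      next
        case A: 2
        then show ?thesis using 1 unfolding v' unfolding i
          by (simp add: ini_def lo_def bit_symbol_def nth_pair_code)
      next
        case A: 3
        then show ?thesis using 1 unfolding v' unfolding i
          by (simp add: ini_def lo_def bit_symbol_def nth_pair_code)
      next
        case A: (4 l)
        then show ?thesis using 1 unfolding v' unfolding i
          by (simp add: ini_def lo_def nth_pair_code)
      qed
    qed
  next
    case 2
    then show ?thesis by (simp add: val_def init nth_Cons' blank_tape_def ini_def)
  next
    case 3
    then show ?thesis using K_pos by (simp add: val_def init ini_def)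
  next
    case 4
    have "snd ((input_tape ?z # replicate (K - 1) blank_tape) ! (K - 1)) = 0"
      by (simp add: nth_Cons' blank_tape_def input_tape_def)
    then show ?thesis using 4 by (auto simp: val_def init ini_def)
  qed
qed

section \<open>Satisfying assignments and accepting runs\<close>

lemma sat_complete:
  assumes w: "length w \<le> certlen x"
    and acc: "fst (snd (run M (pair_code x w) (T x)) ! (K - 1)) 0 = 2"
  shows "\<exists>\<tau>. sat x \<tau>"
proof -
  let ?z = "pair_code x w"
  let ?v = "val ?z (R x)"
  define \<tau> where "\<tau> = (\<lambda>(t, k, i, a). if k = K + 2 then i = R x \<and> com ?z t = a else ?v t k i = a)"
  have "(\<exists>f. pos x r t c k i b f \<and> \<tau> f) \<or> (\<exists>f. neg x r t c k i b f \<and> \<not> \<tau> f)"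
    if cl: "clause x r t c k i b" for r t c k i b
  proof (rule ccontr)
    assume "\<not> ?thesis"
    then have no: "\<And>f. pos x r t c k i b f \<Longrightarrow> \<not> \<tau> f" "\<And>f. neg x r t c k i b f \<Longrightarrow> \<tau> f" by blast+
    have c: "c < C" and k: "k \<le> K + 1" and i: "i < B x" using cl by (auto simp: clause_def)
    consider "r = 0" | "r = 1" "1 \<le> i" | "r = 2" "\<not> (k = 0 \<and> lo x \<le> i \<and> i < hi x)"
      | "r = 3" "lo x \<le> i" "i < hi x" | "r = 4" "lo x \<le> i" "i + 1 < hi x" | "r = 5" "b \<noteq> 2"
      using cl by (auto simp: clause_def)
    then show False
    proof cases
      case 1
      have "?v t k' (R x) = sy c k'" if "k' \<le> K" for k'
        using no(2)[of "(t, k', R x, sy c k')"] 1 that by (simp add: neg_def \<tau>_def)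
      from com_unique[OF c this[symmetric]] show False
        using no(1)[of "(t, K + 2, R x, c)"] 1 by (simp add: pos_def \<tau>_def)
    next
      case 2
      have c': "com ?z t = c"
        using no(2)[of "(t, K + 2, R x, c)"] 2 by (simp add: neg_def \<tau>_def)
      have b: "?v t k i = b"
        using no(2)[of "(t, k, i, b)"] 2 k by (simp add: neg_def \<tau>_def)
      let ?f = "(t + 1, k, i + mv c k - 1, if i = R x \<and> k \<le> K then wr c k else b)"
      have "pos x r t c k i b ?f" using 2 by (simp add: pos_def)
      moreover have "\<tau> ?f"
        using val_Suc[OF k 2(2), of ?z "R x" t] k unfolding c' b by (simp add: \<tau>_def)
      ultimately show False using no(1) by blast
    next
      case 3
      then have "?v 0 k i = ini x k i" using val_0[OF k, of x w i] w by (auto simp: hi_def)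
      then show False
        using no(1)[of "(0, k, i, ini x k i)"] 3 k by (simp add: pos_def \<tau>_def)
    next
      case 4
      have "?v 0 0 i \<le> 2"
        using val_0[of 0 x w i] ini_bound[of x 0 i] by (auto simp: bit_symbol_def)
      then show False
        using no(1)[of "(0, 0, i, ?v 0 0 i)"] 4 by (simp add: pos_def \<tau>_def)
    next
      case 5
      have "?v 0 0 i = 0" using no(2)[of "(0, 0, i, 0)"] 5 by (simp add: neg_def \<tau>_def)
      \<comment> \<open>The symbols of \<open>w\<close> are \<open>1\<close> and \<open>2\<close>,
        so a blank certificate cell lies beyond \<open>w\<close>, and so does its right
        neighbour.\<close>
      then have "\<not> i < lo x + length w" using 5 val_0[of 0 x w i] by (auto simp: bit_symbol_def split: if_splits)
      then have "?v 0 0 (i + 1) = 0" using 5 val_0[of 0 x w "i + 1"] by (simp add: ini_def lo_def)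
      then show False using no(1)[of "(0, 0, i + 1, 0)"] 5 by (simp add: pos_def \<tau>_def)
    next
      case 6
      let ?h = "snd (snd (run M ?z (T x)) ! (K - 1))"
      have "\<tau> (T x, K + 1, i, 1)" by (rule no(2)) (simp add: neg_def 6(1))
      then have v1: "?v (T x) (K + 1) i = 1" by (simp add: \<tau>_def)
      have v: "?v (T x) (K + 1) i = of_bool (?h + int i = int (R x))" by (simp add: val_def)
      have "?h + int i = int (R x)"
      proof (rule ccontr)
        assume "?h + int i \<noteq> int (R x)"
        then show False using v1 unfolding v by simp
      qed
      then have h: "?h + int i - int (R x) = 0" by simp
      have "\<tau> (T x, K - 1, i, b)" by (rule no(2)) (simp add: neg_def 6(1))
      then have "?v (T x) (K - 1) i = b" using K_pos by (simp add: \<tau>_def)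
      moreover have "?v (T x) (K - 1) i = fst (snd (run M ?z (T x)) ! (K - 1)) (?h + int i - int (R x))"
        using K_pos by (simp add: val_def)
      ultimately show False using acc 6(2) unfolding h by simp
    qed
  qed
  then have "sat x \<tau>" unfolding sat_def by blast
  then show ?thesis by (rule exI[of _ \<tau>])
qed

text \<open>Forward derivation along the run. A fact moves by at most one column per step, so the
  range of derived columns shrinks by one on each side.\<close>

lemma sat_run:
  assumes sat: "sat x \<tau>" and init: "\<And>k i. k \<le> K + 1 \<Longrightarrow> i < B x \<Longrightarrow> \<tau> (0, k, i, val z (R x) 0 k i)"
    and vb: "\<And>t k i. val z (R x) t k i < B x"
  shows "t \<le> T x \<Longrightarrow> k \<le> K + 1 \<Longrightarrow> t + 1 \<le> i \<Longrightarrow> i + t + 1 \<le> 2 * R x \<Longrightarrow> \<tau> (t, k, i, val z (R x) t k i)"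
proof (induction t arbitrary: k i)
  case 0
  then show ?case using init B_bounds[of x] by simp
next
  case (Suc t)
  let ?v = "val z (R x)" and ?c = "com z t"
  have RT: "t + 1 \<le> R x" "R x + t + 1 \<le> 2 * R x" using Suc.prems by (simp_all add: R_def)
  have t: "t < T x" using Suc.prems by simp
  have c: "?c < C" by (rule com)
  have C: "\<tau> (t, K + 2, R x, ?c)"
  proof -
    have cl: "clause x 0 t ?c 0 0 0" using t c B_bounds[of x] by (simp add: clause_def)
    have "\<tau> f" if "neg x 0 t ?c 0 0 0 f" for f
      using that Suc.IH[OF _ _ RT] t by (cases f) (auto simp: neg_def sy_com[of _ z t "R x"])
    then obtain f where "pos x 0 t ?c 0 0 0 f" "\<tau> f"
      using sat cl unfolding sat_def by blast
    then show ?thesis by (cases f) (auto simp: pos_def)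
  qed
  \<comment> \<open>The column whose content arrives in column \<open>i\<close>.\<close>
  define i0 where "i0 = i + 1 - mv ?c k"
  have i0: "t + 1 \<le> i0" "i0 + t + 1 \<le> 2 * R x" "i = i0 + mv ?c k - 1" "1 \<le> i0"
    using Suc.prems mv_bound[of ?c k] by (auto simp: i0_def)
  let ?b = "?v t k i0"
  have cl: "clause x 1 t ?c k i0 ?b"
    using t c B_bounds[of x] Suc.prems i0 vb by (simp add: clause_def)
  have "\<tau> f" if "neg x 1 t ?c k i0 ?b f" for f
    using that C Suc.IH[of k i0] i0 Suc.prems by (cases f) (auto simp: neg_def)
  then obtain f where "pos x 1 t ?c k i0 ?b f" "\<tau> f"
    using sat cl unfolding sat_def by blast
  then have "\<tau> (Suc t, k, i0 + mv ?c k - 1, if i0 = R x \<and> k \<le> K then wr ?c k else ?b)"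
    by (cases f) (auto simp: pos_def)
  then show ?case using val_Suc[OF Suc.prems(2) i0(4), of z "R x" t] i0(3) by simp
qed

lemma val_bound: "val z s t k i < B x"
proof -
  have "val z s t k i < width \<or> val z s t k i \<le> 1"
    using run_ok(1)[of z t] run_ok(4)[of k z t] by (auto simp: val_def width_def less_max_iff_disj)
  then show ?thesis by (auto simp: B_def)
qed

lemma sat_sound:
  assumes sat: "sat x \<tau>"
  shows "\<exists>w. length w \<le> certlen x \<and> fst (snd (run M (pair_code x w) (T x)) ! (K - 1)) 0 = 2"
proof -
  \<comment> \<open>The certificate ends before the first cell that the assignment allows to be
    blank, if there is one; rule \<open>4\<close> then makes all later certificate cells
    blank.\<close>
  define l where "l = (LEAST j. j = certlen x \<or> \<tau> (0, 0, lo x + j, 0))"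
  have l: "l = certlen x \<or> \<tau> (0, 0, lo x + l, 0)"
    unfolding l_def by (rule LeastI[where k = "certlen x"]) simp
  have lc: "l \<le> certlen x" unfolding l_def by (rule Least_le) simp
  have less_l: "\<not> \<tau> (0, 0, lo x + j, 0)" if "j < l" for j
    using not_less_Least[OF that[unfolded l_def]] by blast
  \<comment> \<open>The assignment may allow both \<open>1\<close> and \<open>2\<close> in a cell;
    the bit is then read as \<open>True\<close>. A cell before \<open>l\<close> that does not allow
    \<open>2\<close> must allow \<open>1\<close>, by rule \<open>3\<close>.\<close>
  define w where "w = map (\<lambda>j. \<tau> (0, 0, lo x + j, 2)) [0..<l]"
  have len: "length w = l" by (simp add: w_def)
  let ?z = "pair_code x w"
  let ?v = "val ?z (R x)"
  have C: "0 < C" using com(1) by (rule le_less_trans[OF le0])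
  have blank: "\<tau> (0, 0, lo x + j, 0)" if "l \<le> j" "j < certlen x" for j
    using that
  proof (induction j rule: dec_induct)
    case base
    then show ?case using l by simp
  next
    case (step j)
    have cl: "clause x 4 0 0 0 (lo x + j) 0"
      using step C B_bounds[of x] by (simp add: clause_def hi_def)
    have "\<tau> f" if "neg x 4 0 0 0 (lo x + j) 0 f" for f
      using that step by (cases f) (auto simp: neg_def)
    then obtain f where "pos x 4 0 0 0 (lo x + j) 0 f" "\<tau> f"
      using sat cl unfolding sat_def by blast
    then show ?case by (cases f) (auto simp: pos_def)
  qed
  have init: "\<tau> (0, k, i, ?v 0 k i)" if k: "k \<le> K + 1" and i: "i < B x" for k i
  proof (cases "k = 0 \<and> lo x \<le> i \<and> i < hi x")
    case True
    then obtain j where j: "i = lo x + j" "j < certlen x"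
      by (auto simp: hi_def dest!: le_Suc_ex)
    show ?thesis
    proof (cases "j < l")
      case jl: True
      have cl: "clause x 3 0 0 0 i 0"
        using True C i B_bounds[of x] by (simp add: clause_def)
      have "\<not> neg x 3 0 0 0 i 0 f" for f by (cases f) (auto simp: neg_def)
      then obtain f where "pos x 3 0 0 0 i 0 f" "\<tau> f"
        using sat cl unfolding sat_def by blast
      then obtain a where a: "a \<le> 2" "\<tau> (0, 0, i, a)" by (cases f) (auto simp: pos_def)
      have "a \<noteq> 0"
      proof
        assume "a = 0"
        then show False using a(2) less_l[OF jl] j(1) by simp
      qed
      then have "a = 1 \<or> a = 2" using a by auto
      moreover have "?v 0 k i = bit_symbol (\<tau> (0, 0, i, 2))"
        using True val_0[OF k, of x w i] j jl len by (simp add: w_def)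
      ultimately show ?thesis using a True by (auto simp: bit_symbol_def)
    next
      case False
      then have "?v 0 k i = 0"
        using True val_0[OF k, of x w i] j len by (simp add: ini_def lo_def)
      then show ?thesis using blank[of j] False j True by simp
    qed
  next
    case False
    then have v: "?v 0 k i = ini x k i"
      using val_0[OF k, of x w i] len lc by (auto simp: hi_def)
    have cl: "clause x 2 0 0 k i 0"
      using False C i k B_bounds[of x] by (simp add: clause_def)
    have "\<not> neg x 2 0 0 k i 0 f" for f by (cases f) (auto simp: neg_def)
    then obtain f where "pos x 2 0 0 k i 0 f" "\<tau> f"
      using sat cl unfolding sat_def by blast
    then show ?thesis using v by (cases f) (auto simp: pos_def)
  qed
  note derived = sat_run[OF sat init val_bound]
  let ?h = "snd (snd (run M ?z (T x)) ! (K - 1))"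
  have h: "\<bar>?h\<bar> \<le> int (T x)" using run_ok(3) K_pos by simp
  \<comment> \<open>The column of the origin of the last tape at the final time.\<close>
  define i where "i = nat (int (R x) - ?h)"
  have hi: "?h + int i - int (R x) = 0" "T x + 1 \<le> i" "i + T x + 1 \<le> 2 * R x"
    using h by (auto simp: i_def R_def)
  have v: "?v (T x) (K + 1) i = 1" "?v (T x) (K - 1) i = fst (snd (run M ?z (T x)) ! (K - 1)) 0"
    using hi(1) K_pos by (simp_all add: val_def)
  have org: "\<tau> (T x, K + 1, i, 1)" using derived[of "T x" "K + 1" i] hi v by simp
  let ?b = "?v (T x) (K - 1) i"
  have out: "\<tau> (T x, K - 1, i, ?b)" using derived[of "T x" "K - 1" i] hi by simp
  have "?b = 2"
  proof (rule ccontr)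
    assume "?b \<noteq> 2"
    then have cl: "clause x 5 0 0 0 i ?b"
      using C hi B_bounds[of x] val_bound by (simp add: clause_def)
    have "\<tau> f" if "neg x 5 0 0 0 i ?b f" for f
      using that org out by (cases f) (auto simp: neg_def)
    then obtain f where "pos x 5 0 0 0 i ?b f"
      using sat cl unfolding sat_def by blast
    then show False by (cases f) (auto simp: pos_def)
  qed
  then show ?thesis using v len lc by auto
qed

end

section \<open>The reduction\<close>

context tableau_defs
begin

text \<open>A vertex is a number with seven digits in base \<open>B x\<close>, the first of which is its kind.\<close>

definition fact_of :: "bool list \<Rightarrow> nat \<Rightarrow> nat \<times> nat \<times> nat \<times> nat" where
  "fact_of x u = (digit (B x) 1 u, digit (B x) 2 u, digit (B x) 3 u, digit (B x) 4 u)"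

text \<open>Clauses share digits \<open>1\<close> to \<open>4\<close> with facts; digits
  \<open>5\<close> and \<open>6\<close> hold the rule and the index into \<open>combos\<close>. For
  literals these two are arbitrary, so each literal has many copies.\<close>

definition vclause :: "bool list \<Rightarrow> nat \<Rightarrow> bool" where
  "vclause x u = clause x (digit (B x) 5 u) (digit (B x) 1 u) (digit (B x) 6 u)
     (digit (B x) 2 u) (digit (B x) 3 u) (digit (B x) 4 u)"

definition vpos :: "bool list \<Rightarrow> nat \<Rightarrow> nat \<times> nat \<times> nat \<times> nat \<Rightarrow> bool" where
  "vpos x u = pos x (digit (B x) 5 u) (digit (B x) 1 u) (digit (B x) 6 u)
     (digit (B x) 2 u) (digit (B x) 3 u) (digit (B x) 4 u)"

definition vneg :: "bool list \<Rightarrow> nat \<Rightarrow> nat \<times> nat \<times> nat \<times> nat \<Rightarrow> bool" where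
  "vneg x u = neg x (digit (B x) 5 u) (digit (B x) 1 u) (digit (B x) 6 u)
     (digit (B x) 2 u) (digit (B x) 3 u) (digit (B x) 4 u)"

definition adj :: "bool list \<Rightarrow> nat \<Rightarrow> nat \<Rightarrow> bool" where
  "adj x = clause_adj (digit (B x) 0) (fact_of x) (vclause x) (vpos x) (vneg x)"

definition order :: "bool list \<Rightarrow> nat" where
  "order x = B x ^ 7"

definition reduction :: "bool list \<Rightarrow> bool list" where
  "reduction x = enc (order x) 0 (adj x)"

lemma vertex_ex:
  assumes "d0 < B x" "d1 < B x" "d2 < B x" "d3 < B x" "d4 < B x" "d5 < B x" "d6 < B x"
  shows "\<exists>u<order x. digit (B x) 0 u = d0 \<and> digit (B x) 1 u = d1 \<and> digit (B x) 2 u = d2 \<and>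
    digit (B x) 3 u = d3 \<and> digit (B x) 4 u = d4 \<and> digit (B x) 5 u = d5 \<and> digit (B x) 6 u = d6"
proof -
  have "\<forall>d\<in>set [d0, d1, d2, d3, d4, d5, d6]. d < B x" using assms by simp
  from digit_surj[OF this] obtain u where "u < B x ^ 7"
    and u: "\<And>j. j < 7 \<Longrightarrow> digit (B x) j u = [d0, d1, d2, d3, d4, d5, d6] ! j"
    by (auto simp: eval_nat_numeral)
  then show ?thesis
    using u[of 0] u[of 1] u[of 2] u[of 3] u[of 4] u[of 5] u[of 6]
    by (intro exI[of _ u]) (simp add: order_def)
qed

lemma clause_graph_reduction:
  "clause_graph (order x) (digit (B x) 0) (fact_of x) (vclause x) (vpos x) (vneg x)"
proof
  show "digit (B x) 0 0 = 0" by (simp add: digit_def)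
  show "\<not> vneg x u f" if "vclause x u" "vpos x u f" for u f
    using that not_pos_neg unfolding vpos_def vneg_def by blast
  fix u f k
  assume cl: "vclause x u" and f: "vpos x u f \<or> vneg x u f" and k: "k = 1 \<or> k = (2 :: nat)"
  obtain t' k' i' a' where f': "f = (t', k', i', a')" by (cases f) auto
  note cl = cl[unfolded vclause_def]
  have "t' < B x" "k' < B x" "i' < B x" "a' < B x"
    using f pos_bound[OF cl, of t' k' i' a'] neg_bound[OF cl, of t' k' i' a']
    unfolding f' vpos_def vneg_def by blast+
  moreover have "k < B x" "0 < B x" using k B_bounds(6)[of x] by auto
  ultimately obtain w where "w < order x" "digit (B x) 0 w = k" "digit (B x) 1 w = t'"
      "digit (B x) 2 w = k'" "digit (B x) 3 w = i'" "digit (B x) 4 w = a'"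
    using vertex_ex[of k x t' k' i' a' 0 0] by blast
  then show "\<exists>w<order x. digit (B x) 0 w = k \<and> fact_of x w = f"
    unfolding f' fact_of_def by blast
qed

lemma sat_vertices:
  "(\<forall>u<order x. digit (B x) 0 u = 3 \<and> vclause x u \<longrightarrow>
     (\<exists>f. vpos x u f \<and> \<tau> f) \<or> (\<exists>f. vneg x u f \<and> \<not> \<tau> f)) \<longleftrightarrow> sat x \<tau>"
proof
  assume *: "\<forall>u<order x. digit (B x) 0 u = 3 \<and> vclause x u \<longrightarrow>
     (\<exists>f. vpos x u f \<and> \<tau> f) \<or> (\<exists>f. vneg x u f \<and> \<not> \<tau> f)"
  show "sat x \<tau>"
    unfolding sat_def
  proof (intro allI impI)
    fix r t c k i b assume cl: "clause x r t c k i b"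
    have "3 < B x" using B_bounds(6)[of x] by simp
    with clause_bound[OF cl] obtain u where u: "u < order x" "digit (B x) 0 u = 3"
        "digit (B x) 1 u = t" "digit (B x) 2 u = k" "digit (B x) 3 u = i" "digit (B x) 4 u = b"
        "digit (B x) 5 u = r" "digit (B x) 6 u = c"
      using vertex_ex[of 3 x t k i b r c] by blast
    then show "(\<exists>f. pos x r t c k i b f \<and> \<tau> f) \<or> (\<exists>f. neg x r t c k i b f \<and> \<not> \<tau> f)"
      using *[rule_format, of u] cl by (simp add: vclause_def vpos_def vneg_def)
  qed
next
  assume "sat x \<tau>"
  then show "\<forall>u<order x. digit (B x) 0 u = 3 \<and> vclause x u \<longrightarrow>
     (\<exists>f. vpos x u f \<and> \<tau> f) \<or> (\<exists>f. vneg x u f \<and> \<not> \<tau> f)"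
    unfolding sat_def vclause_def vpos_def vneg_def by blast
qed

lemma order_pos: "0 < order x"
  using B_bounds(6)[of x] by (simp add: order_def)

lemma reduction_in_SHED_on:
  assumes D: "\<And>N A. simple_adj N A \<Longrightarrow> no_triangle N A \<Longrightarrow> D (graph_of N A)"
  shows "reduction x \<in> SHED_on D \<longleftrightarrow> \<not> (\<exists>\<tau>. sat x \<tau>)"
proof -
  interpret cg: clause_graph "order x" "digit (B x) 0" "fact_of x" "vclause x" "vpos x" "vneg x"
    by (rule clause_graph_reduction)
  note simple = cg.simple_adj_clause[folded adj_def] and nt = cg.no_triangle_clause[folded adj_def]
  have "reduction x \<in> SHED_on D \<longleftrightarrow> \<not> (\<exists>W. refutes (order x) (adj x) 0 W)"
    unfolding reduction_def SHED_on_enc[OF simple order_pos] shedding_graph_of[OF simple order_pos]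
    using D[OF simple nt] by simp
  also have "\<dots> \<longleftrightarrow> \<not> (\<exists>\<tau>. sat x \<tau>)"
    using cg.refutes_clause_iff[folded adj_def] unfolding sat_vertices by simp
  finally show ?thesis .
qed

section \<open>The adjacency predicate in bounded arithmetic\<close>

lemma barith_params:
  "barith (\<lambda>x e. certlen x)" "barith (\<lambda>x e. T x)" "barith (\<lambda>x e. R x)" "barith (\<lambda>x e. B x)"
  "barith (\<lambda>x e. lo x)" "barith (\<lambda>x e. hi x)" "barith (\<lambda>x e. order x)"
  unfolding order_def hi_def lo_def B_def R_def T_def certlen_def
  by (intro barith_intros)+

lemma barith_digit: "barith f \<Longrightarrow> barith (\<lambda>x e. digit (B x) j (f x e))"
  unfolding digit_def by (intro barith_intros barith_params)

lemma barith_sy: "barith f \<Longrightarrow> barith g \<Longrightarrow> barith (\<lambda>x e. sy (f x e) (g x e))"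
  by (rule barith_table[where m = C and n = "K + 1"]) (auto simp: sy_def)

lemma barith_wr: "barith f \<Longrightarrow> barith g \<Longrightarrow> barith (\<lambda>x e. wr (f x e) (g x e))"
  by (rule barith_table[where m = C and n = "K + 1"]) (auto simp: wr_def)

lemma barith_mv: "barith f \<Longrightarrow> barith g \<Longrightarrow> barith (\<lambda>x e. mv (f x e) (g x e))"
  by (rule barith_table[where m = C and n = "K + 2"]) (auto simp: mv_def)

lemma barith_ini: "barith f \<Longrightarrow> barith g \<Longrightarrow> barith (\<lambda>x e. ini x (f x e) (g x e))"
  by (rule barith_comp2[where F = ini]) (unfold ini_def, intro barith_intros barith_params)

lemmas tableau_intros = barith_intros barith_params barith_digit barith_sy barith_wr barith_mv barith_ini

lemma barithp_vclause: "barith f \<Longrightarrow> barithp (\<lambda>x e. vclause x (f x e))"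
  by (rule barithp_comp1[where P = vclause]) (unfold vclause_def clause_def, intro tableau_intros)

lemma barithp_vpos: "barith f \<Longrightarrow> barith g \<Longrightarrow> barithp (\<lambda>x e. vpos x (f x e) (fact_of x (g x e)))"
  by (rule barithp_comp2[where P = "\<lambda>x u w. vpos x u (fact_of x w)"])
    (unfold vpos_def pos_def fact_of_def prod.case, intro tableau_intros)

lemma barithp_vneg: "barith f \<Longrightarrow> barith g \<Longrightarrow> barithp (\<lambda>x e. vneg x (f x e) (fact_of x (g x e)))"
  by (rule barithp_comp2[where P = "\<lambda>x u w. vneg x u (fact_of x w)"])
    (unfold vneg_def neg_def fact_of_def prod.case, intro tableau_intros)

lemma barithp_same_fact:
  "barith f \<Longrightarrow> barith g \<Longrightarrow> barithp (\<lambda>x e. fact_of x (f x e) = fact_of x (g x e))"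
  unfolding fact_of_def prod.inject by (intro tableau_intros)

lemma barithp_adj: "barith f \<Longrightarrow> barith g \<Longrightarrow> barithp (\<lambda>x e. adj x (f x e) (g x e))"
  unfolding adj_def clause_adj_def clause_arc_def
  by (intro tableau_intros barithp_vclause barithp_vpos barithp_vneg barithp_same_fact)

lemma poly_time_reduction: "poly_time reduction"
proof -
  \<comment> \<open>The length of a code with vertex \<open>0\<close> as its distinguished
    vertex.\<close>
  let ?N = "\<lambda>x. order x + 0 + 2 + order x * order x"
  have f: "barith (\<lambda>x e. ?N x)"
    by (intro tableau_intros)
  have g: "barith (\<lambda>x e. of_bool (word_bit (order x) 0 (adj x) (e 0)))"
    unfolding word_bit_def by (intro tableau_intros barithp_adj)
  have "reduction = (\<lambda>x. map (\<lambda>i. of_bool (word_bit (order x) 0 (adj x) i) \<noteq> (0 :: nat)) [0..<?N x])"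
    by (simp add: fun_eq_iff reduction_def enc_conv_map del: upt_Suc)
  with poly_time_barith[OF f g] show ?thesis by simp
qed

end

lemma coNP_reducible_SHED_on:
  assumes D: "\<And>N A. simple_adj N A \<Longrightarrow> no_triangle N A \<Longrightarrow> D (graph_of N A)"
    and L: "L \<in> class_coNP"
  shows "poly_reducible L (SHED_on D)"
proof -
  obtain V q where V: "V \<in> class_P"
    and L_iff: "\<And>x. x \<in> - L \<longleftrightarrow> (\<exists>w. length w \<le> poly q (length x) \<and> pair_code x w \<in> V)"
    using L unfolding class_coNP_def class_NP_def mem_Collect_eq by (elim bexE exE) blast
  obtain M p where wf: "wf_tm M" and M: "computes_in_time M (\<lambda>x. [x \<in> V]) (poly p)"
    using V unfolding class_P_def poly_time_def by blast
  interpret tableau M p q by standard (rule wf)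
  \<comment> \<open>\<open>T x\<close> allows for the longest certificates; on shorter ones the
    machine halts no later than that and then idles.\<close>
  have run: "fst (snd (run M (pair_code x w) (T x)) ! (K - 1)) 0 = 2 \<longleftrightarrow> pair_code x w \<in> V"
    if "length w \<le> certlen x" for x w
    unfolding K_def T_def
    by (rule accepts_run[OF wf M]) (use that in \<open>simp add: poly_nat_mono\<close>)
  have "x \<in> - L \<longleftrightarrow> (\<exists>\<tau>. sat x \<tau>)" for x
  proof
    assume "x \<in> - L"
    then obtain w where "length w \<le> certlen x" "pair_code x w \<in> V"
      using L_iff by (auto simp: certlen_def)
    then show "\<exists>\<tau>. sat x \<tau>" using sat_complete run by blast
  next
    assume "\<exists>\<tau>. sat x \<tau>"
    then obtain w where "length w \<le> certlen x" "fst (snd (run M (pair_code x w) (T x)) ! (K - 1)) 0 = 2"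
      using sat_sound by blast
    then show "x \<in> - L" using L_iff run by (auto simp: certlen_def)
  qed
  then have "x \<in> L \<longleftrightarrow> reduction x \<in> SHED_on D" for x
    using reduction_in_SHED_on[of D x] D by blast
  then show ?thesis
    unfolding poly_reducible_def using poly_time_reduction by blast
qed

theorem theorem2p2:
  shows "coNP_complete SHED \<and> coNP_complete SHED_triangle_free"
proof
  show "coNP_complete SHED"
    unfolding coNP_complete_def SHED_def
    \<comment> \<open>The flag \<open>False\<close> switches off the triangle test of the
      verifier.\<close>
    using SHED_on_coNP[of "\<lambda>_. True" False] coNP_reducible_SHED_on[of "\<lambda>_. True"] by simp
  show "coNP_complete SHED_triangle_free"
    unfolding coNP_complete_def SHED_triangle_free_def
    using SHED_on_coNP[of triangle_free True] coNP_reducible_SHED_on[of triangle_free]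
    by (simp add: triangle_free_graph_of)
qed

end
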